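(* Let $0<\alpha,\beta<\infty$, let $u,v\in H(\mathbb{B})$, and let $\varphi,\psi:\mathbb{B}\to\mathbb{B}$ be holomorphic. Assume that there is a constant $C>0$ such that both $$\inf_{a}\ \frac{1-|\varphi(a)|^2}{|1-\langle \varphi(a),\xi_a\rangle|}>C\qquad\text{and}\qquad \inf_{a}\ \frac{1-|\psi(a)|^2}{|1-\langle \psi(a),\zeta_a\rangle|}>C,$$ where $$\xi_a=\frac{\Phi_{\varphi(a)}(\psi(a))}{|\Phi_{\varphi(a)}(\psi(a))|},\qquad \zeta_a=\frac{\Phi_{\psi(a)}(\varphi(a))}{|\Phi_{\psi(a)}(\varphi(a))|},$$ and the infima are over all $a\in\mathbb{B}$ with $\varphi(a)\ne\psi(a)$. Suppose that $uC_\varphi:H_\alpha^\infty\to H_\beta^\infty$ and $vC_\psi:H_\alpha^\infty\to H_\beta^\infty$ are bounded. Then $$\|uC_\varphi-vC_\psi\|_{e,H_\alpha^\infty\to H_\beta^\infty}\simeq \limsup_{j\to\infty}\sup_{\xi\in\partial\mathbb{B}}\frac{\|u\langle\varphi,\xi\rangle^j-v\langle\psi,\xi\rangle^j\|_\beta}{\|\langle z,\xi\rangle^j\|_\alpha}+\limsup_{j\to\infty}\sup_{\xi,\xi'\in\partial\mathbb{B}}\frac{\|u\langle\varphi,\xi\rangle^j\langle\varphi,\xi'\rangle-v\langle\psi,\xi\rangle^j\langle\psi,\xi'\rangle\|_\beta}{\|\langle z,\xi\rangle^j\langle z,\xi'\rangle\|_\alpha},$$ i.e. each side is at most a positive constant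 times the other, the constants depending only on $n,\alpha,\beta$ and $C$.
   Context: $\mathbb{B}$ is the open unit ball of $\mathbb{C}^n$ ($n\ge 1$), $\partial\mathbb{B}$ its boundary, $\langle\cdot,\cdot\rangle$ the standard Hermitian inner product (linear in the first variable), $H(\mathbb{B})$ the space of holomorphic functions $\mathbb{B}\to\mathbb{C}$. For $a\in\mathbb{B}\setminus\{0\}$, $\Phi_a(z)=\dfrac{a-P_az-s_aQ_az}{1-\langle z,a\rangle}$, where $s_a=\sqrt{1-|a|^2}$, $P_az=\frac{\langle z,a\rangle}{\langle a,a\rangle}a$, $Q_az=z-P_az$; and $\Phi_0(z)=-z$. One has $\Phi_w(z)=0$ exactly when $z=w$. For $\gamma>0$ and $f\in H(\mathbb{B})$, $\|f\|_\gamma=\sup_{z\in\mathbb{B}}(1-|z|^2)^\gamma|f(z)|\in[0,\infty]$, and $H_\gamma^\infty=\{f\in H(\mathbb{B}):\|f\|_\gamma<\infty\}$, a Banach space under $\|\cdot\|_\gamma$. For $u\in H(\mathbb{B})$ and a holomorphic self-map $\varphi$ of $\mathbb{B}$, the weighted composition operator is $uC_\varphi f(z)=u(z)f(\varphi(z))$. $\langle\varphi,\xi\rangle$ denotes the function $z\mapsto\langle\varphi(z),\xi\rangle$; in denominators $\langle z,\xi\rangle$ denotes the function $z\mapsto\langle z,\xi\rangle$. The essential norm of a bounded linear operator $T:X\to Y$ between Banach spaces is $\|T\|_{e,X\to Y}=\inf\{\|T-K\|_{X\to Y}:K:X\to Y\text{ compact linear}\}$, with $\|\cdot\|_{X\to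 Y}$ the operator norm. *)

theory Defs
  imports "HOL-Analysis.Analysis"
begin

definition herm :: "complex ^ 'n \<Rightarrow> complex ^ 'n \<Rightarrow> complex" where
  "herm z w = (\<Sum>i\<in>UNIV. z $ i * cnj (w $ i))"

abbreviation unit_ball :: "(complex ^ 'n) set" where
  "unit_ball \<equiv> ball 0 1"

text \<open>Holomorphic on the ball: real (Frechet) differentiable at every point with a
  complex-linear derivative.  Values outside the ball are irrelevant.\<close>

definition holo_ball :: "(complex ^ 'n \<Rightarrow> complex) \<Rightarrow> bool" where
  "holo_ball f \<longleftrightarrow>
     (\<forall>z\<in>unit_ball. \<exists>D. (f has_derivative D) (at z) \<and> (\<forall>c x. D (c *s x) = c * D x))"

definition holo_self_map :: "(complex ^ 'n \<Rightarrow> complex ^ 'n) \<Rightarrow> bool" where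
  "holo_self_map \<phi> \<longleftrightarrow> (\<forall>i. holo_ball (\<lambda>z. \<phi> z $ i)) \<and> \<phi> ` unit_ball \<subseteq> unit_ball"

definition Pproj :: "complex ^ 'n \<Rightarrow> complex ^ 'n \<Rightarrow> complex ^ 'n" where
  "Pproj a z = (herm z a / herm a a) *s a"

definition Qproj :: "complex ^ 'n \<Rightarrow> complex ^ 'n \<Rightarrow> complex ^ 'n" where
  "Qproj a z = z - Pproj a z"

definition Phi :: "complex ^ 'n \<Rightarrow> complex ^ 'n \<Rightarrow> complex ^ 'n" where
  "Phi a z =
     (if a = 0 then - z
      else (1 / (1 - herm z a)) *s (a - Pproj a z - sqrt (1 - (norm a)\<^sup>2) *\<^sub>R Qproj a z))"

definition wnorm :: "real \<Rightarrow> (complex ^ 'n \<Rightarrow> complex) \<Rightarrow> ennreal" where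
  "wnorm \<gamma> f = (SUP z\<in>unit_ball. ennreal ((1 - (norm z)\<^sup>2) powr \<gamma> * norm (f z)))"

text \<open>Elements of the weighted space are total functions set to \<open>0\<close> off the ball, so that
  HOL equality is equality of functions on the ball.\<close>

definition Hinf :: "real \<Rightarrow> (complex ^ 'n \<Rightarrow> complex) set" where
  "Hinf \<gamma> = {f. holo_ball f \<and> wnorm \<gamma> f < \<infinity> \<and> (\<forall>z. z \<notin> unit_ball \<longrightarrow> f z = 0)}"

definition Hdist :: "real \<Rightarrow> (complex ^ 'n \<Rightarrow> complex) \<Rightarrow> (complex ^ 'n \<Rightarrow> complex) \<Rightarrow> real" where
  "Hdist \<gamma> f g = enn2real (wnorm \<gamma> (\<lambda>z. f z - g z))"

definition wcomp ::
  "(complex ^ 'n \<Rightarrow> complex) \<Rightarrow> (complex ^ 'n \<Rightarrow> complex ^ 'n) \<Rightarrow>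
   (complex ^ 'n \<Rightarrow> complex) \<Rightarrow> (complex ^ 'n \<Rightarrow> complex)" where
  "wcomp u \<phi> f = (\<lambda>z. if z \<in> unit_ball then u z * f (\<phi> z) else 0)"

text \<open>Operators are HOL functions on all of \<^typ>\<open>complex ^ 'n \<Rightarrow> complex\<close>; only their
  values on \<open>Hinf \<alpha>\<close> matter below.\<close>

definition linear_op ::
  "real \<Rightarrow> real \<Rightarrow> ((complex ^ 'n \<Rightarrow> complex) \<Rightarrow> (complex ^ 'n \<Rightarrow> complex)) \<Rightarrow> bool" where
  "linear_op \<alpha> \<beta> T \<longleftrightarrow> T ` Hinf \<alpha> \<subseteq> Hinf \<beta> \<and>
     (\<forall>f\<in>Hinf \<alpha>. \<forall>g\<in>Hinf \<alpha>. T (\<lambda>z. f z + g z) = (\<lambda>z. T f z + T g z)) \<and>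
     (\<forall>f\<in>Hinf \<alpha>. \<forall>c. T (\<lambda>z. c * f z) = (\<lambda>z. c * T f z))"

definition op_norm ::
  "real \<Rightarrow> real \<Rightarrow> ((complex ^ 'n \<Rightarrow> complex) \<Rightarrow> (complex ^ 'n \<Rightarrow> complex)) \<Rightarrow> ennreal" where
  "op_norm \<alpha> \<beta> T = (SUP f\<in>{f \<in> Hinf \<alpha>. wnorm \<alpha> f \<le> 1}. wnorm \<beta> (T f))"

definition bounded_op ::
  "real \<Rightarrow> real \<Rightarrow> ((complex ^ 'n \<Rightarrow> complex) \<Rightarrow> (complex ^ 'n \<Rightarrow> complex)) \<Rightarrow> bool" where
  "bounded_op \<alpha> \<beta> T \<longleftrightarrow> linear_op \<alpha> \<beta> T \<and> op_norm \<alpha> \<beta> T < \<infinity>"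

definition compact_op ::
  "real \<Rightarrow> real \<Rightarrow> ((complex ^ 'n \<Rightarrow> complex) \<Rightarrow> (complex ^ 'n \<Rightarrow> complex)) \<Rightarrow> bool" where
  "compact_op \<alpha> \<beta> K \<longleftrightarrow> linear_op \<alpha> \<beta> K \<and>
     (let Y = Metric_space.mtopology (Hinf \<beta>) (Hdist \<beta>)
      in compactin Y (Y closure_of (K ` {f \<in> Hinf \<alpha>. wnorm \<alpha> f \<le> 1})))"

definition ess_norm ::
  "real \<Rightarrow> real \<Rightarrow> ((complex ^ 'n \<Rightarrow> complex) \<Rightarrow> (complex ^ 'n \<Rightarrow> complex)) \<Rightarrow> ennreal" where
  "ess_norm \<alpha> \<beta> T = (INF K\<in>{K. compact_op \<alpha> \<beta> K}. op_norm \<alpha> \<beta> (\<lambda>f z. T f z - K f z))"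

text \<open>The \<open>Hdist\<close> are metrics, so \<^const>\<open>Metric_space.mtopology\<close> above is the norm topology.\<close>

lemma wnorm_triangle:
  fixes f g :: "complex ^ 'n \<Rightarrow> complex"
  shows "wnorm \<gamma> (\<lambda>z. f z + g z) \<le> wnorm \<gamma> f + wnorm \<gamma> g"
  unfolding wnorm_def
proof (rule SUP_least)
  fix z :: "complex ^ 'n" assume z: "z \<in> unit_ball"
  let ?w = "(1 - (norm z)\<^sup>2) powr \<gamma>"
  have "ennreal (?w * norm (f z + g z)) \<le> ennreal (?w * norm (f z) + ?w * norm (g z))"
    by (intro ennreal_leI) (simp add: mult_left_mono norm_triangle_ineq flip: distrib_left)
  also have "\<dots> = ennreal (?w * norm (f z)) + ennreal (?w * norm (g z))"
    by simp
  also have "\<dots> \<le> (SUP z\<in>unit_ball. ennreal ((1 - (norm z)\<^sup>2) powr \<gamma> * norm (f z)))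
      + (SUP z\<in>unit_ball. ennreal ((1 - (norm z)\<^sup>2) powr \<gamma> * norm (g z)))"
    by (intro add_mono SUP_upper z)
  finally show "ennreal (?w * norm (f z + g z)) \<le> \<dots>" .
qed

lemma wnorm_uminus: "wnorm \<gamma> (\<lambda>z. - f z) = wnorm \<gamma> f"
  by (simp add: wnorm_def)

lemma wnorm_diff: "wnorm \<gamma> (\<lambda>z. f z - g z) \<le> wnorm \<gamma> f + wnorm \<gamma> g"
  using wnorm_triangle[of \<gamma> f "\<lambda>z. - g z"] by (simp add: wnorm_uminus)

lemma wnorm_eq_0_iff:
  fixes f :: "complex ^ 'n \<Rightarrow> complex"
  shows "wnorm \<gamma> f = 0 \<longleftrightarrow> (\<forall>z\<in>unit_ball. f z = 0)"
proof -
  have "(1 - (norm z)\<^sup>2) powr \<gamma> * norm (f z) \<le> 0 \<longleftrightarrow> f z = 0" if "z \<in> unit_ball" for z :: "complex ^ 'n"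
  proof -
    have "(norm z)\<^sup>2 < 1"
      using that by (simp add: abs_square_less_1)
    then have "(1 - (norm z)\<^sup>2) powr \<gamma> > 0"
      by simp
    then show ?thesis
      by (simp add: mult_le_0_iff)
  qed
  then show ?thesis
    by (simp add: wnorm_def flip: bot_ennreal) (simp add: bot_ennreal ennreal_eq_0_iff)
qed

lemma Metric_space_Hinf: "Metric_space (Hinf \<gamma>) (Hdist \<gamma>)"
proof
  fix f g h :: "complex ^ 'n \<Rightarrow> complex"
  show "0 \<le> Hdist \<gamma> f g"
    by (simp add: Hdist_def)
  show "Hdist \<gamma> f g = Hdist \<gamma> g f"
    using wnorm_uminus[of \<gamma> "\<lambda>z. f z - g z"] by (simp add: Hdist_def)
  have fin: "wnorm \<gamma> (\<lambda>z. p z - q z) < top" if "p \<in> Hinf \<gamma>" "q \<in> Hinf \<gamma>" for p q :: "complex ^ 'n \<Rightarrow> complex"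
    using wnorm_diff[of \<gamma> p q] that
    by (auto simp: Hinf_def intro: le_less_trans)
  show "Hdist \<gamma> f g = 0 \<longleftrightarrow> f = g" if "f \<in> Hinf \<gamma>" "g \<in> Hinf \<gamma>"
  proof -
    have "Hdist \<gamma> f g = 0 \<longleftrightarrow> wnorm \<gamma> (\<lambda>z. f z - g z) = 0"
      using fin[OF that] by (auto simp: Hdist_def enn2real_eq_0_iff)
    also have "\<dots> \<longleftrightarrow> (\<forall>z\<in>unit_ball. f z = g z)"
      by (simp add: wnorm_eq_0_iff)
    also have "\<dots> \<longleftrightarrow> f = g"
    proof
      assume *: "\<forall>z\<in>unit_ball. f z = g z"
      show "f = g"
      proof
        fix z show "f z = g z"
          using * that by (cases "z \<in> unit_ball") (auto simp: Hinf_def)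
      qed
    qed simp
    finally show ?thesis .
  qed
  show "Hdist \<gamma> f h \<le> Hdist \<gamma> f g + Hdist \<gamma> g h"
    if "f \<in> Hinf \<gamma>" "g \<in> Hinf \<gamma>" "h \<in> Hinf \<gamma>"
  proof -
    have "wnorm \<gamma> (\<lambda>z. f z - h z) \<le> wnorm \<gamma> (\<lambda>z. f z - g z) + wnorm \<gamma> (\<lambda>z. g z - h z)"
      using wnorm_triangle[of \<gamma> "\<lambda>z. f z - g z" "\<lambda>z. g z - h z"] by simp
    then have "Hdist \<gamma> f h \<le> enn2real (wnorm \<gamma> (\<lambda>z. f z - g z) + wnorm \<gamma> (\<lambda>z. g z - h z))"
      using fin that by (auto simp: Hdist_def intro!: enn2real_mono)
    also have "\<dots> = Hdist \<gamma> f g + Hdist \<gamma> g h"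
      using fin that by (simp add: Hdist_def enn2real_plus)
    finally show ?thesis .
  qed
qed

end

theory Submission
  imports Defs "HOL-Complex_Analysis.Great_Picard"
begin

text \<open>
  Write \<open>T = u C\<^sub>\<phi> - v C\<^sub>\<psi>\<close>, \<open>E\<close> for its essential norm, and \<open>L\<close>, \<open>M\<close> for the two upper limits on
  the right-hand side. The theorem follows from \<open>L \<le> E\<close>, \<open>M \<le> E\<close> and \<open>E \<le> c L\<close>, where \<open>c\<close>
  depends only on \<open>\<alpha>\<close>.

  \<^bold>\<open>Lower bound.\<close> The normalised functions \<open>\<langle>z,\<xi>\<rangle>^j\<close> and \<open>\<langle>z,\<xi>\<rangle>^j \<langle>z,\<xi>'\<rangle>\<close> are bounded on the ball
  and tend to zero locally uniformly as \<open>j\<close> grows, uniformly in \<open>\<xi>\<close> and \<open>\<xi>'\<close>, because their norms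
  decay more slowly than \<open>s^j\<close> for every \<open>s < 1\<close>. A compact operator \<open>K\<close> sends such a
  sequence to a norm null sequence (lemma \<open>compact_op_vanishes\<close>), so on it \<open>T\<close> is asymptotically no
  larger than \<open>T - K\<close>. The usual argument for this step goes through weak convergence and the
  dual of a little space; here a gliding hump replaces it. Any number \<open>n\<close> of members of the sequence
  can be chosen with sum of norm at most 4, whereas, if the images did not tend to zero, the image
  of the sum would grow linearly in \<open>n\<close>.

  \<^bold>\<open>Upper bound.\<close> Take for \<open>K\<close> the operator \<open>f \<mapsto> T (f(r \<cdot>))\<close>, which is compact by Montel's theorem
  and the completeness of the target space. For \<open>g = f - f(r \<cdot>)\<close>, which is small on each fixed
  compact part of the ball when \<open>r\<close> is near 1, one has to bound \<open>\<omega> |u g(p) - v g(q)|\<close>, where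
  \<open>p = \<phi>(a)\<close>, \<open>q = \<psi>(a)\<close> and \<open>\<omega> = (1 - |a|\<^sup>2)^\<beta>\<close>. The term of a point that stays in a
  fixed compact part is small. Let \<open>p\<close> be near the sphere, \<open>x = |p|\<close>, \<open>\<delta> = 1 - x\<close>, and let \<open>y\<close> be the component of \<open>q\<close> along \<open>p\<close>.
  If \<open>N\<close> bounds the tail of the sequence whose upper limit is \<open>L\<close>, testing with \<open>\<xi> = p/x\<close> gives
  \<open>\<omega> |u x^i - v y^i| \<le> c N \<delta>^\<alpha>\<close> for all \<open>i \<ge> 1/\<delta>\<close>. Comparing different such
  exponents controls both \<open>\<omega> |u| min(1, |x - y|/\<delta>)\<close> and, when \<open>y\<close> is close to \<open>x\<close>, \<open>\<omega> |u - v|\<close> by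
  \<open>c N \<delta>^\<alpha>\<close> (lemma \<open>coefficient_estimates\<close>). The growth of \<open>g\<close> at \<open>p\<close> is of order \<open>\<delta>^-\<alpha>\<close>, which
  cancels the factor \<open>\<delta>^\<alpha>\<close>.

  What remains is to compare \<open>g(p)\<close> with \<open>g(q)\<close> when \<open>|x - y|\<close> is small relative to \<open>\<delta>\<close>. This is where
  the constant \<open>C\<close> enters: it forces the direction of \<open>\<Phi>\<^sub>p(q)\<close> to be nearly that of \<open>p\<close>, so that \<open>q\<close> is
  as close to \<open>p\<close> in the orthogonal directions as it is along \<open>p\<close> (lemma \<open>Phi_direction_bound\<close>).
  The Schwarz lemma on the complex line through \<open>p\<close> and \<open>q\<close> then gives
  \<open>|g(p) - g(q)| \<le> c \<delta>^-\<alpha> |x - y|/\<delta>\<close>.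
\<close>

section \<open>The Hermitian form and the weighted norms\<close>
lemma herm_linear_left:
  "herm (x + y) w = herm x w + herm y w" "herm (x - y) w = herm x w - herm y w"
  "herm (c *s x) w = c * herm x w" "herm (r *\<^sub>R x) w = of_real r * herm x w"
  unfolding herm_def
  by (simp_all add: algebra_simps sum.distrib sum_subtractf sum_distrib_left
      scaleR_conv_of_real[where 'a = complex])

lemma cnj_herm: "cnj (herm x y) = herm y x"
  by (simp add: herm_def mult.commute)

lemma herm_linear_right:
  "herm x (y + w) = herm x y + herm x w" "herm x (y - w) = herm x y - herm x w"
  "herm x (c *s y) = cnj c * herm x y" "herm x (r *\<^sub>R y) = of_real r * herm x y"
  unfolding herm_def
  by (simp_all add: algebra_simps sum.distrib sum_subtractf sum_distrib_left
      scaleR_conv_of_real[where 'a = complex])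

lemma Re_herm: "Re (herm x y) = x \<bullet> y"
  by (simp add: herm_def inner_vec_def inner_complex_def)

lemma herm_self: "herm x x = of_real ((norm x)\<^sup>2)"
proof (rule complex_eqI)
  show "Re (herm x x) = Re (of_real ((norm x)\<^sup>2))"
    by (simp only: Re_herm dot_square_norm Re_complex_of_real)
  show "Im (herm x x) = Im (of_real ((norm x)\<^sup>2))"
    by (simp add: herm_def)
qed

lemma norm_smult_vec: "norm (c *s (x :: complex ^ 'n)) = cmod c * norm x"
proof -
  have "norm (c *s x) = L2_set (\<lambda>i. cmod c * norm (x $ i)) UNIV"
    by (simp add: norm_vec_def norm_mult)
  also have "\<dots> = cmod c * norm x"
    by (simp add: norm_vec_def L2_set_right_distrib)
  finally show ?thesis .
qed

lemma norm_herm_le: "cmod (herm x y) \<le> norm x * norm y"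
proof (cases "herm x y = 0")
  case False
  define c where "c = cnj (herm x y) / of_real (cmod (herm x y))"
  have c: "cmod c = 1" "c * herm x y = of_real (cmod (herm x y))"
    using False
    by (simp_all add: c_def norm_divide field_simps complex_norm_square[symmetric] power2_eq_square)
  have "cmod (herm x y) = Re (herm (c *s x) y)"
    by (simp add: herm_linear_left c)
  also have "\<dots> \<le> norm (c *s x) * norm y"
    unfolding Re_herm by (rule norm_cauchy_schwarz)
  finally show ?thesis by (simp add: norm_smult_vec c)
qed simp

lemma norm_power2_smult_add:
  "(norm (x + c *s y))\<^sup>2 = (norm x)\<^sup>2 + 2 * Re (c * herm y x) + (cmod c)\<^sup>2 * (norm (y::complex^'n))\<^sup>2"
proof -
  have "(norm (x + c *s y))\<^sup>2 = (x + c *s y) \<bullet> (x + c *s y)"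
    by (simp add: power2_norm_eq_inner)
  also have "\<dots> = (norm x)\<^sup>2 + 2 * ((c *s y) \<bullet> x) + (norm (c *s y))\<^sup>2"
    by (simp add: inner_add_left inner_add_right inner_commute power2_norm_eq_inner)
  finally show ?thesis
    by (simp add: norm_smult_vec power_mult_distrib herm_linear_left flip: Re_herm)
qed

lemma weight_pos: "norm (z::'a::real_normed_vector) < 1 \<Longrightarrow> 0 < 1 - (norm z)\<^sup>2"
  by (simp add: abs_square_less_1)

lemma wnorm_leI:
  assumes "\<And>z. norm z < 1 \<Longrightarrow> (1 - (norm z)\<^sup>2) powr \<gamma> * cmod (f z) \<le> B"
  shows "wnorm \<gamma> f \<le> ennreal B"
  unfolding wnorm_def by (rule SUP_least) (simp add: assms ennreal_leI)

lemma wnorm_upper: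
  assumes "norm z < 1"
  shows "ennreal ((1 - (norm z)\<^sup>2) powr \<gamma> * cmod (f z)) \<le> wnorm \<gamma> f"
  unfolding wnorm_def by (rule SUP_upper2[of z]) (use assms in auto)

lemma wnorm_leD:
  assumes "wnorm \<gamma> f \<le> ennreal B" "0 \<le> B" "norm z < 1"
  shows "(1 - (norm z)\<^sup>2) powr \<gamma> * cmod (f z) \<le> B"
  using order_trans[OF wnorm_upper assms(1)] assms(2,3) by simp

lemma wnorm_le_pointwise:
  assumes "wnorm \<gamma> f \<le> ennreal B" "0 \<le> B" "0 \<le> \<gamma>" "0 < s" "s \<le> 1 - (norm z)\<^sup>2"
  shows "cmod (f z) \<le> B * s powr - \<gamma>"
proof -
  have "(norm z)\<^sup>2 < 1"
    using assms(4,5) by simp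
  then have "norm z < 1"
    by (simp add: abs_square_less_1)
  have "s powr \<gamma> * cmod (f z) \<le> (1 - (norm z)\<^sup>2) powr \<gamma> * cmod (f z)"
    using assms by (intro mult_right_mono powr_mono2) auto
  also have "\<dots> \<le> B"
    using assms \<open>norm z < 1\<close> by (intro wnorm_leD) auto
  finally show ?thesis
    using assms(4) by (simp add: powr_minus field_simps)
qed

lemma wnorm_cong: "(\<And>z. norm z < 1 \<Longrightarrow> f z = g z) \<Longrightarrow> wnorm \<gamma> f = wnorm \<gamma> g"
  unfolding wnorm_def by (rule SUP_cong) auto

lemma wnorm_cmult: "wnorm \<gamma> (\<lambda>z. c * f z) = ennreal (cmod c) * wnorm \<gamma> f"
proof -
  have "ennreal ((1 - (norm z)\<^sup>2) powr \<gamma> * cmod (c * f z)) =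
      ennreal (cmod c) * ennreal ((1 - (norm z)\<^sup>2) powr \<gamma> * cmod (f z))" for z
    by (simp add: norm_mult mult_ac flip: ennreal_mult')
  then show ?thesis
    by (simp only: wnorm_def SUP_mult_left_ennreal)
qed

section \<open>Holomorphic functions on complex lines\<close>
lemma holo_ballD:
  assumes "holo_ball f" "norm z < 1"
  obtains D where "(f has_derivative D) (at z)" "\<And>c x. D (c *s x) = c * D x"
proof -
  have "z \<in> unit_ball"
    using assms(2) by simp
  then show ?thesis
    using assms(1) that unfolding holo_ball_def by blast
qed

lemma slice_has_field_derivative:
  fixes f :: "complex ^ 'n \<Rightarrow> complex"
  assumes "(f has_derivative D) (at (z + l *s v))" "\<And>c x. D (c *s x) = c * D x"
  shows "((\<lambda>\<mu>. f (z + \<mu> *s v)) has_field_derivative D v) (at l)"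
proof -
  have "((\<lambda>\<mu>. z + \<mu> *s v) has_derivative (\<lambda>\<mu>. \<mu> *s v)) (at l)"
  proof -
    have "bounded_linear (\<lambda>\<mu>. \<mu> *s v)"
      by (rule bounded_linear_intro[of _ "norm v"])
        (simp_all add: norm_smult_vec vec_eq_iff algebra_simps)
    then show ?thesis
      by (auto intro!: derivative_eq_intros bounded_linear_imp_has_derivative)
  qed
  from has_derivative_compose[OF this assms(1)]
  show ?thesis
    unfolding has_field_derivative_def
    by (rule has_derivative_eq_rhs) (simp add: assms(2) fun_eq_iff mult.commute)
qed

text \<open>The one-variable Schwarz lemma, applied to \<open>\<zeta> \<mapsto> f (z + R \<zeta> v) - f z\<close>. It serves as Lipschitz
  estimate, as Cauchy estimate for the derivative, and, with discs that depend on the points, as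
  invariant estimate near the sphere.\<close>
lemma slice_Schwarz:
  fixes z v :: "complex ^ 'n"
  assumes f: "holo_ball f" and R: "0 < R"
    and disc: "\<And>l. cmod l < R \<Longrightarrow> norm (z + l *s v) < 1 \<and> cmod (f (z + l *s v)) \<le> B"
  shows "1 < R \<Longrightarrow> cmod (f (z + v) - f z) \<le> 2 * B / R"
    and "(f has_derivative D) (at z) \<Longrightarrow> (\<And>c x. D (c *s x) = c * D x) \<Longrightarrow> cmod (D v) \<le> 2 * B / R"
proof -
  have z: "norm z < 1" "cmod (f z) \<le> B" and B: "0 \<le> B"
    using disc[of 0] R by (auto intro: order_trans[OF norm_ge_zero])
  \<comment> \<open>The bound in the Schwarz lemma is strict, hence the extra \<open>e\<close>.\<close>
  have main: "(1 < R \<longrightarrow> cmod (f (z + v) - f z) \<le> (2 * B + e) / R) \<and>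
    ((f has_derivative D) (at z) \<longrightarrow> (\<forall>c x. D (c *s x) = c * D x) \<longrightarrow> cmod (D v) \<le> (2 * B + e) / R)"
    if e: "0 < e" for e
  proof -
    define K where "K = 2 * B + e"
    have K: "0 < K"
      using B e by (simp add: K_def)
    define h where "h = (\<lambda>\<zeta>. (f (z + (of_real R * \<zeta>) *s v) - f z) / of_real K)"
    have in_disc: "cmod (of_real R * \<zeta>) < R" if "cmod \<zeta> < 1" for \<zeta>
      using R that by (simp add: norm_mult)
    have der: "\<exists>d. (h has_field_derivative d) (at \<zeta>)" if \<zeta>: "cmod \<zeta> < 1" for \<zeta>
    proof -
      obtain D' where D': "(f has_derivative D') (at (z + (of_real R * \<zeta>) *s v))"
          "\<And>c x. D' (c *s x) = c * D' x"
        using holo_ballD[OF f conjunct1[OF disc[OF in_disc[OF \<zeta>]]]] by blast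
      show ?thesis
        unfolding h_def
        by (rule exI)
          (use slice_has_field_derivative[OF D'] K in
            \<open>auto intro!: derivative_eq_intros DERIV_chain2[where f="\<lambda>\<mu>. f (z + \<mu> *s v)"]\<close>)
    qed
    have hol: "h holomorphic_on ball 0 1"
      unfolding holomorphic_on_def field_differentiable_def
      using der by (meson has_field_derivative_at_within mem_ball_0)
    have h0: "h 0 = 0"
      by (simp add: h_def)
    have bd: "cmod (h \<zeta>) < 1" if "cmod \<zeta> < 1" for \<zeta>
    proof -
      have "cmod (f (z + (of_real R * \<zeta>) *s v) - f z) \<le> B + B"
        using disc[OF in_disc[OF that]] z(2) norm_triangle_ineq4 by (smt (verit))
      also have "\<dots> < K"
        using e by (simp add: K_def)
      finally show ?thesis
        using K by (simp add: h_def norm_divide)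
    qed
    note S = Schwarz_Lemma[OF hol h0 bd]
    have "cmod (f (z + v) - f z) \<le> K / R" if "1 < R"
    proof -
      have "cmod (h (1 / of_real R)) \<le> cmod (1 / of_real R)"
        by (rule S(1)) (use that R in \<open>auto simp: norm_divide\<close>)
      then show ?thesis
        using R K by (simp add: h_def norm_divide field_simps)
    qed
    moreover have "cmod (D v) \<le> K / R"
      if D: "(f has_derivative D) (at z)" "\<And>c x. D (c *s x) = c * D x"
    proof -
      have "((\<lambda>\<mu>. f (z + \<mu> *s v)) has_field_derivative D v) (at (of_real R * 0))"
        using slice_has_field_derivative[of f D z 0 v] D by simp
      then have "(h has_field_derivative (D v * of_real R / of_real K)) (at 0)"
        unfolding h_def using K
        by (auto intro!: derivative_eq_intros DERIV_chain2[where f="\<lambda>\<mu>. f (z + \<mu> *s v)"])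
      then have "cmod (D v * of_real R / of_real K) \<le> 1"
        using S(2)[of 0] by (simp add: DERIV_imp_deriv)
      then show ?thesis
        using R K by (simp add: norm_divide norm_mult field_simps)
    qed
    ultimately show ?thesis unfolding K_def by blast
  qed
  have lim: "x \<le> 2 * B / R" if "\<And>e. 0 < e \<Longrightarrow> x \<le> (2 * B + e) / R" for x
  proof (rule field_le_epsilon)
    fix e :: real assume "0 < e"
    then show "x \<le> 2 * B / R + e"
      using that[of "e * R"] R by (simp add: add_divide_distrib)
  qed
  show "1 < R \<Longrightarrow> cmod (f (z + v) - f z) \<le> 2 * B / R"
    using main by (intro lim) blast
  show "(f has_derivative D) (at z) \<Longrightarrow> (\<And>c x. D (c *s x) = c * D x) \<Longrightarrow> cmod (D v) \<le> 2 * B / R"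
    using main by (intro lim) blast
qed

lemma local_Lipschitz_estimate:
  assumes f: "holo_ball f" and bd: "\<And>x. norm x < s \<Longrightarrow> cmod (f x) \<le> B"
    and s: "s \<le> 1" and z: "norm z \<le> r" and rs: "r < s"
  shows "norm (w - z) < s - r \<Longrightarrow> cmod (f w - f z) \<le> 2 * B * norm (w - z) / (s - r)"
    and "(f has_derivative D) (at z) \<Longrightarrow> (\<And>c x. D (c *s x) = c * D x) \<Longrightarrow>
      cmod (D v) \<le> 2 * B * norm v / (s - r)"
proof -
  have disc: "norm (z + l *s v) < 1 \<and> cmod (f (z + l *s v)) \<le> B"
    if "cmod l < (s - r) / norm v" "v \<noteq> 0" for l v
  proof -
    have "norm (z + l *s v) \<le> norm z + cmod l * norm v"
      using norm_triangle_ineq[of z "l *s v"] by (simp add: norm_smult_vec)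
    also have "\<dots> < s"
      using that z by (simp add: field_simps)
    finally show ?thesis
      using bd s by auto
  qed
  show "cmod (f w - f z) \<le> 2 * B * norm (w - z) / (s - r)" if "norm (w - z) < s - r"
  proof (cases "w = z")
    case False
    then show ?thesis
      using slice_Schwarz(1)[OF f, of "(s - r) / norm (w - z)" z "w - z" B] disc[of _ "w - z"] that rs
      by (simp add: field_simps)
  qed simp
  show "cmod (D v) \<le> 2 * B * norm v / (s - r)"
    if D: "(f has_derivative D) (at z)" "\<And>c x. D (c *s x) = c * D x"
  proof (cases "v = 0")
    case True
    then show ?thesis
      using D(2)[of 0 0] by simp
  next
    case False
    then show ?thesis
      using slice_Schwarz(2)[OF f, of "(s - r) / norm v" z v B D] disc[of _ v] D rs
      by simp
  qed
qed

section \<open>Closure properties and limits of holomorphic functions\<close>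
lemma holo_ball_const: "holo_ball (\<lambda>z. c)"
  unfolding holo_ball_def by (auto intro!: exI[of _ "\<lambda>_. 0"])

lemma holo_ball_diff:
  assumes "holo_ball f" "holo_ball g" shows "holo_ball (\<lambda>z. f z - g z)"
  unfolding holo_ball_def
proof
  fix z :: "complex ^ 'a" assume "z \<in> unit_ball"
  then obtain D E where "(f has_derivative D) (at z)" "\<And>c x. D (c *s x) = c * D x"
     "(g has_derivative E) (at z)" "\<And>c x. E (c *s x) = c * E x"
    using assms unfolding holo_ball_def by blast
  then show "\<exists>D. ((\<lambda>z. f z - g z) has_derivative D) (at z) \<and> (\<forall>c x. D (c *s x) = c * D x)"
    by (intro exI[of _ "\<lambda>x. D x - E x"]) (auto intro!: derivative_eq_intros simp: algebra_simps)
qed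

lemma holo_ball_mult:
  assumes "holo_ball f" "holo_ball g" shows "holo_ball (\<lambda>z. f z * g z)"
  unfolding holo_ball_def
proof
  fix z :: "complex ^ 'a" assume "z \<in> unit_ball"
  then obtain D E where "(f has_derivative D) (at z)" "\<And>c x. D (c *s x) = c * D x"
     "(g has_derivative E) (at z)" "\<And>c x. E (c *s x) = c * E x"
    using assms unfolding holo_ball_def by blast
  then show "\<exists>D. ((\<lambda>z. f z * g z) has_derivative D) (at z) \<and> (\<forall>c x. D (c *s x) = c * D x)"
    by (intro exI[of _ "\<lambda>x. f z * E x + D x * g z"])
       (auto intro!: derivative_eq_intros simp: algebra_simps)
qed

lemma holo_ball_add:
  assumes "holo_ball f" "holo_ball g" shows "holo_ball (\<lambda>z. f z + g z)"
  using holo_ball_diff[OF assms(1) holo_ball_diff[OF holo_ball_const[of 0] assms(2)]] by simp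

lemma holo_ball_herm: "holo_ball (\<lambda>z. herm z w)"
proof -
  have "bounded_linear (\<lambda>z. herm z w)"
    by (rule bounded_linear_intro[of _ "norm w"])
       (simp_all add: herm_linear_left scaleR_conv_of_real[where 'a = complex] norm_herm_le)
  then show ?thesis
    unfolding holo_ball_def
    by (auto intro!: exI[of _ "\<lambda>z. herm z w"] bounded_linear_imp_has_derivative
        simp: herm_linear_left)
qed

lemma holo_ball_power: "holo_ball f \<Longrightarrow> holo_ball (\<lambda>z. f z ^ k)"
  by (induction k) (auto intro: holo_ball_const holo_ball_mult)

lemma holo_ball_cong:
  assumes "holo_ball f" "\<And>z. norm z < 1 \<Longrightarrow> f z = g z" shows "holo_ball g"
  unfolding holo_ball_def
proof
  fix z :: "complex ^ 'a" assume z: "z \<in> unit_ball"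
  then obtain D where D: "(f has_derivative D) (at z)" "\<And>c x. D (c *s x) = c * D x"
    using assms unfolding holo_ball_def by blast
  have "(g has_derivative D) (at z)"
    by (rule has_derivative_transform_within_open[OF D(1) open_ball z]) (simp add: assms(2))
  then show "\<exists>D. (g has_derivative D) (at z) \<and> (\<forall>c x. D (c *s x) = c * D x)"
    using D(2) by blast
qed

lemma holo_ball_scaleR_arg:
  assumes "holo_ball f" "0 \<le> r" "r \<le> 1" shows "holo_ball (\<lambda>z. f (r *\<^sub>R z))"
  unfolding holo_ball_def
proof
  fix z :: "complex ^ 'a" assume z: "z \<in> unit_ball"
  have "norm (r *\<^sub>R z) < 1"
    using mult_right_mono[OF assms(3), of "norm z"] z assms(2) by simp
  then obtain D where D: "(f has_derivative D) (at (r *\<^sub>R z))" "\<And>c x. D (c *s x) = c * D x"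
    using holo_ballD[OF assms(1)] by blast
  have "((\<lambda>z. r *\<^sub>R z) has_derivative (\<lambda>z. r *\<^sub>R z)) (at z)"
    by (auto intro!: derivative_eq_intros)
  from has_derivative_compose[OF this D(1)]
  have "((\<lambda>z. f (r *\<^sub>R z)) has_derivative (\<lambda>x. D (r *\<^sub>R x))) (at z)" .
  moreover have "r *\<^sub>R (c *s x) = c *s (r *\<^sub>R x)" for c and x :: "complex ^ 'a"
    by (simp add: vec_eq_iff)
  then have "D (r *\<^sub>R (c *s x)) = c * D (r *\<^sub>R x)" for c x
    by (simp only: D(2))
  ultimately show "\<exists>D. ((\<lambda>z. f (r *\<^sub>R z)) has_derivative D) (at z) \<and> (\<forall>c x. D (c *s x) = c * D x)"
    by blast
qed

text \<open>The Cauchy estimate turns locally uniform convergence of the functions into locally uniform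
  convergence of their derivatives, so the limit is differentiable; complex linearity of the
  derivatives passes to the limit pointwise.\<close>
lemma holo_ball_locally_uniform_limit:
  fixes F :: "nat \<Rightarrow> complex ^ 'n \<Rightarrow> complex"
  assumes holo: "\<And>n. holo_ball (F n)"
    and Cauchy: "\<And>s e. s < 1 \<Longrightarrow> 0 < e \<Longrightarrow>
      \<exists>N. \<forall>m\<ge>N. \<forall>n\<ge>N. \<forall>z. norm z < s \<longrightarrow> cmod (F m z - F n z) \<le> e"
  obtains g where "holo_ball g" "\<And>z. norm z < 1 \<Longrightarrow> (\<lambda>n. F n z) \<longlonglongrightarrow> g z"
proof -
  have "\<forall>n x. \<exists>D. norm x < 1 \<longrightarrow> (F n has_derivative D) (at x) \<and> (\<forall>c h. D (c *s h) = c * D h)"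
    using holo_ballD[OF holo] by metis
  then obtain D where D: "\<And>n x. norm x < 1 \<Longrightarrow> (F n has_derivative D n x) (at x)"
      "\<And>n x c h. norm x < 1 \<Longrightarrow> D n x (c *s h) = c * D n x h"
    by metis
  have D_Cauchy: "\<exists>N. \<forall>m\<ge>N. \<forall>n\<ge>N. \<forall>x h. norm x < s \<longrightarrow> cmod (D m x h - D n x h) \<le> e * norm h"
    if s: "s < 1" and e: "0 < e" for s e
  proof -
    define s' where "s' = (1 + s) / 2"
    have s': "s < s'" "s' < 1"
      using s by (auto simp: s'_def)
    obtain N where N: "\<And>m n z. m \<ge> N \<Longrightarrow> n \<ge> N \<Longrightarrow> norm z < s' \<Longrightarrow>
        cmod (F m z - F n z) \<le> e * (s' - s) / 2"
      using Cauchy[of s' "e * (s' - s) / 2"] s' e by auto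
    have "cmod (D m x h - D n x h) \<le> e * norm h" if "m \<ge> N" "n \<ge> N" "norm x < s" for m n x h
    proof -
      have x: "norm x < 1" "norm x \<le> s"
        using that s by auto
      have "((\<lambda>z. F m z - F n z) has_derivative (\<lambda>h. D m x h - D n x h)) (at x)"
        using D(1)[OF x(1)] by (intro has_derivative_diff) auto
      then have "cmod (D m x h - D n x h) \<le> 2 * (e * (s' - s) / 2) * norm h / (s' - s)"
        using s' D(2)[OF x(1)]
        by (intro local_Lipschitz_estimate(2)[OF holo_ball_diff[OF holo holo] N[OF that(1,2)] _ x(2) s'(1)])
           (auto simp: right_diff_distrib)
      then show ?thesis
        using s' by simp
    qed
    then show ?thesis by blast
  qed
  define D' where "D' = (\<lambda>x h. lim (\<lambda>n. D n x h))"
  have D'_lim: "(\<lambda>n. D n x h) \<longlonglongrightarrow> D' x h" if "norm x < 1" for x h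
  proof -
    obtain s where s: "norm x < s" "s < 1"
      using dense \<open>norm x < 1\<close> by blast
    have "Cauchy (\<lambda>n. D n x h)"
    proof (rule metric_CauchyI)
      fix e :: real assume "0 < e"
      then have "0 < e / (norm h + 1)"
        by (simp add: add_nonneg_pos)
      then obtain N where N: "\<And>m n. m \<ge> N \<Longrightarrow> n \<ge> N \<Longrightarrow>
          cmod (D m x h - D n x h) \<le> e / (norm h + 1) * norm h"
        using D_Cauchy[OF s(2)] s(1) by meson
      have "e / (norm h + 1) * norm h < e"
        using \<open>0 < e\<close> add_nonneg_pos[OF norm_ge_zero[of h] zero_less_one] by (simp add: field_simps)
      then show "\<exists>M. \<forall>m\<ge>M. \<forall>n\<ge>M. dist (D m x h) (D n x h) < e"
        using N by (auto simp: dist_norm intro!: exI[of _ N] intro: le_less_trans)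
    qed
    then show ?thesis
      unfolding D'_def by (simp add: Cauchy_convergent_iff convergent_LIMSEQ_iff)
  qed
  define g where "g = (\<lambda>z. lim (\<lambda>n. F n z))"
  have local: "(\<lambda>n. F n z) \<longlonglongrightarrow> g z \<and> (g has_derivative D' z) (at z)" if z: "norm z < 1" for z
  proof -
    obtain s where s: "norm z < s" "s < 1"
      using dense z by blast
    have "0 < s"
      using s(1) norm_ge_zero by (rule le_less_trans[rotated])
    have "\<exists>G. \<forall>x\<in>ball 0 s. (\<lambda>n. F n x) \<longlonglongrightarrow> G x \<and> (G has_derivative D' x) (at x within ball 0 s)"
    proof (rule has_derivative_sequence[where f' = D])
      show "convex (ball (0 :: complex ^ 'n) s)" "0 \<in> ball (0 :: complex ^ 'n) s"
        using \<open>0 < s\<close> by auto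
      show "(F n has_derivative D n x) (at x within ball 0 s)" if "x \<in> ball 0 s" for n x
        using that s by (auto intro!: has_derivative_at_withinI D(1))
      have "Cauchy (\<lambda>n. F n 0)"
      proof (rule metric_CauchyI)
        fix e :: real assume "0 < e"
        then obtain N where "\<forall>m\<ge>N. \<forall>n\<ge>N. cmod (F m 0 - F n 0) \<le> e / 2"
          using Cauchy[OF s(2), of "e / 2"] \<open>0 < s\<close> by (metis half_gt_zero norm_zero)
        then show "\<exists>M. \<forall>m\<ge>M. \<forall>n\<ge>M. dist (F m 0) (F n 0) < e"
          using \<open>0 < e\<close> by (force simp: dist_norm)
      qed
      then show "(\<lambda>n. F n 0) \<longlonglongrightarrow> lim (\<lambda>n. F n 0)"
        by (simp add: Cauchy_convergent_iff convergent_LIMSEQ_iff)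
      fix e :: real assume "0 < e"
      then obtain N where N: "\<And>m n x h. m \<ge> N \<Longrightarrow> n \<ge> N \<Longrightarrow> norm x < s \<Longrightarrow>
          cmod (D m x h - D n x h) \<le> e * norm h"
        using D_Cauchy[OF s(2)] by meson
      have "cmod (D n x h - D' x h) \<le> e * norm h" if "n \<ge> N" "norm x < s" for n x h
      proof (rule tendsto_upperbound)
        show "(\<lambda>m. cmod (D n x h - D m x h)) \<longlonglongrightarrow> cmod (D n x h - D' x h)"
          using that s by (intro tendsto_intros D'_lim) auto
        show "\<forall>\<^sub>F m in sequentially. cmod (D n x h - D m x h) \<le> e * norm h"
          unfolding eventually_sequentially using N that by blast
      qed simp
      then show "\<forall>\<^sub>F n in sequentially. \<forall>x\<in>ball 0 s. \<forall>h. cmod (D n x h - D' x h) \<le> e * norm h"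
        unfolding eventually_sequentially by (metis mem_ball_0)
    qed
    then obtain G where G: "\<And>x. x \<in> ball 0 s \<Longrightarrow> (\<lambda>n. F n x) \<longlonglongrightarrow> G x"
        "\<And>x. x \<in> ball 0 s \<Longrightarrow> (G has_derivative D' x) (at x within ball 0 s)"
      by blast
    have Gg: "G x = g x" if "x \<in> ball 0 s" for x
      using limI[OF G(1)[OF that]] by (simp add: g_def)
    have zs: "z \<in> ball 0 s"
      using s by simp
    have "(G has_derivative D' z) (at z)"
      using G(2)[OF zs] zs by (simp add: at_within_open[OF zs open_ball])
    then have "(g has_derivative D' z) (at z)"
      by (rule has_derivative_transform_within_open[OF _ open_ball zs]) (rule Gg)
    then show ?thesis
      using G(1)[OF zs] Gg[OF zs] by simp
  qed
  have "D' z (c *s h) = c * D' z h" if "norm z < 1" for z c h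
  proof (rule LIMSEQ_unique)
    show "(\<lambda>n. D n z (c *s h)) \<longlonglongrightarrow> D' z (c *s h)"
      by (rule D'_lim[OF that])
    show "(\<lambda>n. D n z (c *s h)) \<longlonglongrightarrow> c * D' z h"
      unfolding D(2)[OF that] by (intro tendsto_intros D'_lim that)
  qed
  then have "holo_ball g"
    unfolding holo_ball_def using local by (metis mem_ball_0)
  then show thesis
    using local that by blast
qed

section \<open>The weighted spaces are complete\<close>
lemma HinfD:
  assumes "f \<in> Hinf \<gamma>"
  shows "holo_ball f" "wnorm \<gamma> f < top" "\<And>z. \<not> norm z < 1 \<Longrightarrow> f z = 0"
  using assms by (auto simp: Hinf_def)

lemma holo_self_map_norm: "holo_self_map \<phi> \<Longrightarrow> norm z < 1 \<Longrightarrow> norm (\<phi> z) < 1"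
  unfolding holo_self_map_def using mem_ball_0[of z 1] mem_ball_0[of "\<phi> z" 1] by blast

lemma HinfI:
  assumes "holo_ball f" "wnorm \<gamma> f < top" "\<And>z. \<not> norm z < 1 \<Longrightarrow> f z = 0"
  shows "f \<in> Hinf \<gamma>"
  using assms by (auto simp: Hinf_def)

lemma Hinf_add: "f \<in> Hinf \<gamma> \<Longrightarrow> g \<in> Hinf \<gamma> \<Longrightarrow> (\<lambda>z. f z + g z) \<in> Hinf \<gamma>"
  using wnorm_triangle[of \<gamma> f g]
  by (intro HinfI holo_ball_add) (auto simp: HinfD intro: le_less_trans)

lemma Hinf_diff: "f \<in> Hinf \<gamma> \<Longrightarrow> g \<in> Hinf \<gamma> \<Longrightarrow> (\<lambda>z. f z - g z) \<in> Hinf \<gamma>"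
  using wnorm_diff[of \<gamma> f g]
  by (intro HinfI holo_ball_diff) (auto simp: HinfD intro: le_less_trans)

lemma Hinf_cmult: "f \<in> Hinf \<gamma> \<Longrightarrow> (\<lambda>z. c * f z) \<in> Hinf \<gamma>"
  by (intro HinfI holo_ball_mult holo_ball_const) (auto simp: HinfD wnorm_cmult ennreal_mult_less_top)

lemma Hinf_zero: "(\<lambda>z. 0) \<in> Hinf \<gamma>"
  by (intro HinfI holo_ball_const) (simp_all add: wnorm_def)

lemma Hinf_sum:
  "finite I \<Longrightarrow> (\<And>i. i \<in> I \<Longrightarrow> F i \<in> Hinf \<gamma>) \<Longrightarrow> (\<lambda>z. \<Sum>i\<in>I. F i z) \<in> Hinf \<gamma>"
  by (induction rule: finite_induct) (simp_all add: Hinf_add Hinf_zero)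

lemma wnorm_eq_Hdist:
  assumes "f \<in> Hinf \<gamma>" "g \<in> Hinf \<gamma>" shows "wnorm \<gamma> (\<lambda>z. f z - g z) = ennreal (Hdist \<gamma> f g)"
  using HinfD(2)[OF Hinf_diff[OF assms]] by (simp add: Hdist_def)

lemma Hdist_nonneg: "0 \<le> Hdist \<gamma> f g"
  by (simp add: Hdist_def)

lemma Hinf_real_bound:
  assumes "f \<in> Hinf \<gamma>"
  obtains B where "0 \<le> B" "wnorm \<gamma> f = ennreal B"
  using HinfD(2)[OF assms] by (cases "wnorm \<gamma> f") auto

proposition mcomplete_Hinf:
  assumes "0 \<le> \<gamma>"
  shows "Metric_space.mcomplete (Hinf \<gamma> :: (complex ^ 'n \<Rightarrow> complex) set) (Hdist \<gamma>)"
proof -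
  interpret Metric_space "Hinf \<gamma> :: (complex ^ 'n \<Rightarrow> complex) set" "Hdist \<gamma>"
    by (rule Metric_space_Hinf)
  show ?thesis
    unfolding mcomplete_def
  proof (intro allI impI)
    fix F :: "nat \<Rightarrow> complex ^ 'n \<Rightarrow> complex" assume F: "MCauchy F"
    have FH: "F n \<in> Hinf \<gamma>" for n
      using F by (auto simp: MCauchy_def)
    have Cau: "\<exists>N. \<forall>m\<ge>N. \<forall>n\<ge>N. wnorm \<gamma> (\<lambda>z. F m z - F n z) \<le> ennreal e" if "0 < e" for e
      using F that unfolding MCauchy_def
      by (metis FH less_imp_le wnorm_eq_Hdist ennreal_leI)
    have unif: "\<exists>N. \<forall>m\<ge>N. \<forall>n\<ge>N. \<forall>z. norm z < s \<longrightarrow> cmod (F m z - F n z) \<le> e"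
      if s: "s < 1" and e: "0 < e" for s e
    proof (cases "0 < s")
      case False
      then show ?thesis by (metis norm_ge_zero order_le_less_trans)
    next
      case True
      have c: "0 < 1 - s\<^sup>2"
        using s True by (simp add: abs_square_less_1)
      obtain N where N: "\<And>m n. m \<ge> N \<Longrightarrow> n \<ge> N \<Longrightarrow>
          wnorm \<gamma> (\<lambda>z. F m z - F n z) \<le> ennreal (e * (1 - s\<^sup>2) powr \<gamma>)"
        using Cau[of "e * (1 - s\<^sup>2) powr \<gamma>"] c e by auto
      have "cmod (F m z - F n z) \<le> e" if "m \<ge> N" "n \<ge> N" "norm z < s" for m n z
      proof -
        have "1 - s\<^sup>2 \<le> 1 - (norm z)\<^sup>2"
          using that(3) by (simp add: power_mono)
        from wnorm_le_pointwise[OF N[OF that(1,2)] _ assms c this]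
        have "cmod (F m z - F n z) \<le> e * (1 - s\<^sup>2) powr \<gamma> * (1 - s\<^sup>2) powr - \<gamma>"
          using e by simp
        also have "\<dots> = e"
          using c by (simp add: powr_minus)
        finally show ?thesis .
      qed
      then show ?thesis by blast
    qed
    obtain g where g: "holo_ball g" "\<And>z. norm z < 1 \<Longrightarrow> (\<lambda>n. F n z) \<longlonglongrightarrow> g z"
      using holo_ball_locally_uniform_limit[OF HinfD(1)[OF FH] unif] by blast
    define G where "G = (\<lambda>z. if norm z < 1 then g z else 0)"
    have tail: "\<exists>N. \<forall>n\<ge>N. wnorm \<gamma> (\<lambda>z. F n z - G z) \<le> ennreal e" if e: "0 < e" for e
    proof -
      obtain N where N: "\<And>m n. m \<ge> N \<Longrightarrow> n \<ge> N \<Longrightarrow> wnorm \<gamma> (\<lambda>z. F n z - F m z) \<le> ennreal e"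
        using Cau[OF e] by auto
      have "wnorm \<gamma> (\<lambda>z. F n z - G z) \<le> ennreal e" if n: "n \<ge> N" for n
      proof (rule wnorm_leI)
        fix z :: "complex ^ 'n" assume z: "norm z < 1"
        show "(1 - (norm z)\<^sup>2) powr \<gamma> * cmod (F n z - G z) \<le> e"
        proof (rule tendsto_upperbound)
          show "(\<lambda>m. (1 - (norm z)\<^sup>2) powr \<gamma> * cmod (F n z - F m z)) \<longlonglongrightarrow>
              (1 - (norm z)\<^sup>2) powr \<gamma> * cmod (F n z - G z)"
            using g(2)[OF z] z unfolding G_def by (auto intro!: tendsto_intros)
          show "\<forall>\<^sub>F m in sequentially. (1 - (norm z)\<^sup>2) powr \<gamma> * cmod (F n z - F m z) \<le> e"
            unfolding eventually_sequentially
            using wnorm_leD[OF N[OF _ n] less_imp_le[OF e] z] by blast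
        qed simp
      qed
      then show ?thesis by blast
    qed
    have "G \<in> Hinf \<gamma>"
    proof (rule HinfI)
      show "holo_ball G"
        by (rule holo_ball_cong[OF g(1)]) (simp add: G_def)
      obtain N where "wnorm \<gamma> (\<lambda>z. F N z - G z) \<le> ennreal 1"
        using tail[of 1] by auto
      then have "wnorm \<gamma> (F N) + wnorm \<gamma> (\<lambda>z. F N z - G z) < top"
        using HinfD(2)[OF FH[of N]] by (auto intro: le_less_trans)
      then show "wnorm \<gamma> G < top"
        using wnorm_diff[of \<gamma> "F N" "\<lambda>z. F N z - G z"] by (auto intro: le_less_trans)
    qed (simp add: G_def)
    moreover have "\<exists>N. \<forall>n\<ge>N. F n \<in> Hinf \<gamma> \<and> Hdist \<gamma> (F n) G < e" if "0 < e" for e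
    proof -
      obtain N where N: "\<And>n. n \<ge> N \<Longrightarrow> wnorm \<gamma> (\<lambda>z. F n z - G z) \<le> ennreal (e / 2)"
        using tail[of "e / 2"] \<open>0 < e\<close> by auto
      have "Hdist \<gamma> (F n) G \<le> e / 2" if "n \<ge> N" for n
        using N[OF that] \<open>0 < e\<close> unfolding wnorm_eq_Hdist[OF FH \<open>G \<in> Hinf \<gamma>\<close>]
        by (simp add: ennreal_le_iff)
      then show ?thesis
        using FH \<open>0 < e\<close> by (intro exI[of _ N]) fastforce
    qed
    ultimately show "\<exists>G. limitin mtopology F G sequentially"
      by (auto simp: limit_metric_sequentially)
  qed
qed

section \<open>Composition with a dilation is compact\<close>
definition dilation :: "real \<Rightarrow> (complex ^ 'n \<Rightarrow> complex) \<Rightarrow> complex ^ 'n \<Rightarrow> complex" where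
  "dilation r f = (\<lambda>z. if norm z < 1 then f (r *\<^sub>R z) else 0)"

lemma wnorm_dilation_le:
  assumes "0 < r" "r < 1" "0 \<le> \<gamma>"
  shows "wnorm \<gamma> (dilation r f) \<le> wnorm \<gamma> f"
  unfolding wnorm_def[of _ "dilation r f"]
proof (rule SUP_least)
  fix z :: "complex ^ 'a" assume "z \<in> unit_ball"
  then have z: "norm z < 1" by simp
  have le: "norm (r *\<^sub>R z) \<le> norm z"
    using assms mult_right_mono[of r 1 "norm z"] by simp
  have "(norm (r *\<^sub>R z))\<^sup>2 \<le> (norm z)\<^sup>2"
    using le by (intro power_mono) auto
  then have "(1 - (norm z)\<^sup>2) powr \<gamma> \<le> (1 - (norm (r *\<^sub>R z))\<^sup>2) powr \<gamma>"
    using weight_pos[OF z] assms by (intro powr_mono2) auto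
  then have "ennreal ((1 - (norm z)\<^sup>2) powr \<gamma> * cmod (dilation r f z)) \<le>
      ennreal ((1 - (norm (r *\<^sub>R z))\<^sup>2) powr \<gamma> * cmod (f (r *\<^sub>R z)))"
    using z by (auto simp: dilation_def intro!: ennreal_leI mult_right_mono)
  also have "\<dots> \<le> wnorm \<gamma> f"
    using le z by (intro wnorm_upper) simp
  finally show "ennreal ((1 - (norm z)\<^sup>2) powr \<gamma> * cmod (dilation r f z)) \<le> wnorm \<gamma> f" .
qed

lemma dilation_Hinf:
  assumes "0 < r" "r < 1" "0 \<le> \<gamma>" "f \<in> Hinf \<gamma>"
  shows "dilation r f \<in> Hinf \<gamma>"
proof (rule HinfI)
  show "holo_ball (dilation r f)"
    by (rule holo_ball_cong[OF holo_ball_scaleR_arg[of f r]])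
      (use assms HinfD(1)[OF assms(4)] in \<open>auto simp: dilation_def\<close>)
  show "wnorm \<gamma> (dilation r f) < top"
    using wnorm_dilation_le[OF assms(1-3)] HinfD(2)[OF assms(4)] by (rule le_less_trans)
qed (simp add: dilation_def)

text \<open>Montel's theorem on the closed ball of radius \<open>r\<close>: norm bounded functions are uniformly bounded
  and uniformly Lipschitz there. Only the Cauchy property is recorded, since the limit of the images
  under a compact operator is supplied by completeness of the target.\<close>
lemma Montel_dilation:
  fixes f :: "nat \<Rightarrow> complex ^ 'n \<Rightarrow> complex"
  assumes f: "\<And>k. holo_ball (f k)" "\<And>k. wnorm \<alpha> (f k) \<le> 1" and \<alpha>: "0 \<le> \<alpha>" and r: "0 < r" "r < 1"
  obtains k :: "nat \<Rightarrow> nat" where "strict_mono k"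
    "\<And>e. 0 < e \<Longrightarrow> \<exists>N. \<forall>m\<ge>N. \<forall>n\<ge>N. \<forall>z. norm z \<le> r \<longrightarrow> cmod (f (k m) z - f (k n) z) \<le> e"
proof -
  define s where "s = (1 + r) / 2"
  have s: "r < s" "s < 1"
    using r by (auto simp: s_def)
  define B where "B = (1 - s\<^sup>2) powr - \<alpha>"
  have B: "cmod (f k z) \<le> B" if "norm z < s" for k z
  proof -
    have "0 < 1 - s\<^sup>2" "1 - s\<^sup>2 \<le> 1 - (norm z)\<^sup>2"
      using s r that by (auto simp: abs_square_less_1 power_mono)
    from wnorm_le_pointwise[OF _ _ \<alpha> this, of "f k" 1] show ?thesis
      using f(2) by (simp add: B_def)
  qed
  have B0: "0 \<le> B"
    by (simp add: B_def)
  obtain g k where k: "strict_mono (k :: nat \<Rightarrow> nat)" and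
    lim: "\<And>e. 0 < e \<Longrightarrow> \<exists>N. \<forall>n x. n \<ge> N \<and> x \<in> cball 0 r \<longrightarrow> norm (f (k n) x - g x) < e"
  proof (rule Arzela_Ascoli[of "cball 0 r" f B])
    show "norm (f n x) \<le> B" if "x \<in> cball 0 r" for n x
      using that s by (intro B) auto
    fix x :: "complex ^ 'n" and e :: real assume x: "x \<in> cball 0 r" and e: "0 < e"
    define d where "d = min (s - r) (e * (s - r) / (2 * (B + 1)))"
    have d: "0 < d"
      using s e B0 by (auto simp: d_def)
    have "norm (f n x - f n y) < e" if "norm (x - y) < d" for n y
    proof -
      have xy: "norm (y - x) < s - r" "norm (y - x) < e * (s - r) / (2 * (B + 1))"
        using that by (auto simp: d_def norm_minus_commute)
      have "cmod (f n y - f n x) \<le> 2 * B * norm (y - x) / (s - r)"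
        by (rule local_Lipschitz_estimate(1)[OF f(1) B]) (use s x xy in auto)
      also have "\<dots> \<le> 2 * (B + 1) * norm (y - x) / (s - r)"
        using s by (intro divide_right_mono mult_right_mono) auto
      also have "\<dots> < e"
        using xy(2) s B0 by (simp add: field_simps)
      finally show ?thesis by (simp add: norm_minus_commute)
    qed
    then show "\<exists>d>0. \<forall>n y. y \<in> cball 0 r \<and> norm (x - y) < d \<longrightarrow> norm (f n x - f n y) < e"
      using d by blast
  qed auto
  show thesis
  proof (rule that[OF k])
    fix e :: real assume "0 < e"
    then obtain N where N: "\<And>n x. n \<ge> N \<Longrightarrow> norm x \<le> r \<Longrightarrow> cmod (f (k n) x - g x) < e / 2"
      using lim[of "e / 2"] by auto
    have "cmod (f (k m) z - f (k n) z) \<le> e" if "m \<ge> N" "n \<ge> N" "norm z \<le> r" for m n z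
      using norm_triangle_ineq4[of "f (k m) z - g z" "f (k n) z - g z"]
        N[OF that(1,3)] N[OF that(2,3)] by simp
    then show "\<exists>N. \<forall>m\<ge>N. \<forall>n\<ge>N. \<forall>z. norm z \<le> r \<longrightarrow> cmod (f (k m) z - f (k n) z) \<le> e"
      by blast
  qed
qed

text \<open>The multiplier is the image of the constant function 1.\<close>
lemma bounded_wcomp_multiplier:
  assumes "bounded_op \<alpha> \<beta> (wcomp u \<phi>)" "holo_self_map \<phi>" "0 \<le> \<alpha>"
  obtains U where "0 \<le> U" "wnorm \<beta> u \<le> ennreal U"
proof -
  define one :: "complex ^ 'a \<Rightarrow> complex" where "one = (\<lambda>z. if norm z < 1 then 1 else 0)"
  have "one \<in> Hinf \<alpha>"
  proof (rule HinfI)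
    show "holo_ball one"
      by (rule holo_ball_cong[OF holo_ball_const[of 1]]) (simp add: one_def)
    have "wnorm \<alpha> one \<le> ennreal 1"
    proof (rule wnorm_leI)
      fix z :: "complex ^ 'a" assume z: "norm z < 1"
      show "(1 - (norm z)\<^sup>2) powr \<alpha> * cmod (one z) \<le> 1"
        using powr_mono2[of \<alpha> "1 - (norm z)\<^sup>2" 1] weight_pos[OF z] z assms(3) by (simp add: one_def)
    qed
    then show "wnorm \<alpha> one < top"
      by (auto intro: le_less_trans)
  qed (simp add: one_def)
  then have "wcomp u \<phi> one \<in> Hinf \<beta>"
    using assms(1) by (auto simp: bounded_op_def linear_op_def)
  moreover have "wnorm \<beta> (wcomp u \<phi> one) = wnorm \<beta> u"
    using assms(2) by (intro wnorm_cong) (auto simp: wcomp_def one_def holo_self_map_norm)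
  ultimately show thesis
    using that by (metis Hinf_real_bound order_refl)
qed

text \<open>Functions that are uniformly close on the ball of radius \<open>r\<close> have close images, because
  the multipliers have finite norm; so the image of the unit ball is totally bounded.\<close>
lemma compact_op_wcomp_dilation:
  fixes u v :: "complex ^ 'n \<Rightarrow> complex"
  assumes bd: "bounded_op \<alpha> \<beta> (wcomp u \<phi>)" "bounded_op \<alpha> \<beta> (wcomp v \<psi>)"
    and self: "holo_self_map \<phi>" "holo_self_map \<psi>"
    and ab: "0 \<le> \<alpha>" "0 \<le> \<beta>" and r: "0 < r" "r < 1"
  shows "compact_op \<alpha> \<beta> (\<lambda>f z. wcomp u \<phi> (dilation r f) z - wcomp v \<psi> (dilation r f) z)"
    (is "compact_op \<alpha> \<beta> ?K")
proof -
  interpret Y: Metric_space "Hinf \<beta> :: (complex ^ 'n \<Rightarrow> complex) set" "Hdist \<beta>"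
    by (rule Metric_space_Hinf)
  have self': "norm (\<phi> z) < 1" "norm (\<psi> z) < 1" if "norm z < 1" for z
    using self that by (simp_all add: holo_self_map_norm)
  obtain U where U: "0 \<le> U" "wnorm \<beta> u \<le> ennreal U"
    using bounded_wcomp_multiplier[OF bd(1) self(1) ab(1)] .
  obtain V where V: "0 \<le> V" "wnorm \<beta> v \<le> ennreal V"
    using bounded_wcomp_multiplier[OF bd(2) self(2) ab(1)] .
  have K: "?K f \<in> Hinf \<beta>" if "f \<in> Hinf \<alpha>" for f
    using dilation_Hinf[OF r ab(1) that] bd
    by (intro Hinf_diff) (auto simp: bounded_op_def linear_op_def)
  have lin: "linear_op \<alpha> \<beta> ?K"
    unfolding linear_op_def
  proof (intro conjI ballI allI)
    show "?K ` Hinf \<alpha> \<subseteq> Hinf \<beta>"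
      using K by blast
  qed (auto simp: wcomp_def dilation_def fun_eq_iff algebra_simps)
  have "Y.mtotally_bounded (?K ` {f \<in> Hinf \<alpha>. wnorm \<alpha> f \<le> 1})"
    unfolding Y.mtotally_bounded_sequentially
  proof (intro conjI allI impI)
    show "?K ` {f \<in> Hinf \<alpha>. wnorm \<alpha> f \<le> 1} \<subseteq> Hinf \<beta>"
      using K by blast
    fix \<sigma> :: "nat \<Rightarrow> complex ^ 'n \<Rightarrow> complex"
    assume "range \<sigma> \<subseteq> ?K ` {f \<in> Hinf \<alpha>. wnorm \<alpha> f \<le> 1}"
    then have "\<sigma> k \<in> ?K ` {f \<in> Hinf \<alpha>. wnorm \<alpha> f \<le> 1}" for k
      by blast
    then have "\<forall>k. \<exists>f. f \<in> Hinf \<alpha> \<and> wnorm \<alpha> f \<le> 1 \<and> \<sigma> k = ?K f"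
      by blast
    then obtain f where f: "\<And>k. f k \<in> Hinf \<alpha>" "\<And>k. wnorm \<alpha> (f k) \<le> 1" "\<And>k. \<sigma> k = ?K (f k)"
      by (subst (asm) choice_iff) blast
    obtain k :: "nat \<Rightarrow> nat" where k: "strict_mono k"
      "\<And>e. 0 < e \<Longrightarrow> \<exists>N. \<forall>m\<ge>N. \<forall>n\<ge>N. \<forall>z. norm z \<le> r \<longrightarrow> cmod (f (k m) z - f (k n) z) \<le> e"
      using Montel_dilation[where f = f, OF HinfD(1)[OF f(1)] f(2) ab(1) r] that by metis
    have \<sigma>: "\<sigma> n \<in> Hinf \<beta>" for n
      unfolding f(3) by (rule K[OF f(1)])
    have "\<exists>N. \<forall>n n'. N \<le> n \<longrightarrow> N \<le> n' \<longrightarrow> Hdist \<beta> ((\<sigma> \<circ> k) n) ((\<sigma> \<circ> k) n') < e" if e: "0 < e" for e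
    proof -
      define S where "S = U + V + 1"
      define e' where "e' = e / (2 * S)"
      have S: "0 < S"
        using U V by (simp add: S_def)
      have e': "0 < e'" "S * e' = e / 2"
        using e S by (simp_all add: e'_def)
      then have e'_le: "(U + V) * e' < e"
        using e by (simp add: S_def distrib_right)
      obtain N where N: "\<And>m n z. m \<ge> N \<Longrightarrow> n \<ge> N \<Longrightarrow> norm z \<le> r \<Longrightarrow> cmod (f (k m) z - f (k n) z) \<le> e'"
        using k(2)[OF e'(1)] by blast
      have "Hdist \<beta> (\<sigma> (k m)) (\<sigma> (k n)) < e" if mn: "m \<ge> N" "n \<ge> N" for m n
      proof -
        have "wnorm \<beta> (\<lambda>z. \<sigma> (k m) z - \<sigma> (k n) z) \<le> ennreal ((U + V) * e')"
        proof (rule wnorm_leI)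
          fix z :: "complex ^ 'n" assume z: "norm z < 1"
          define \<omega> where "\<omega> = (1 - (norm z)\<^sup>2) powr \<beta>"
          have \<omega>: "0 \<le> \<omega>" "\<omega> * cmod (u z) \<le> U" "\<omega> * cmod (v z) \<le> V"
            using wnorm_leD[OF U(2,1) z] wnorm_leD[OF V(2,1) z] by (auto simp: \<omega>_def)
          define F where "F = (\<lambda>w. f (k m) (r *\<^sub>R w) - f (k n) (r *\<^sub>R w))"
          have F: "cmod (F w) \<le> e'" if "norm w < 1" for w
            unfolding F_def using that r mult_left_mono[of "norm w" 1 r] by (intro N mn) auto
          have eq: "\<sigma> (k m) z - \<sigma> (k n) z = u z * F (\<phi> z) - v z * F (\<psi> z)"
            using z self'[OF z] by (simp add: f(3) wcomp_def dilation_def F_def algebra_simps)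
          have "\<omega> * cmod (u z * F (\<phi> z) - v z * F (\<psi> z)) \<le>
              \<omega> * (cmod (u z) * cmod (F (\<phi> z)) + cmod (v z) * cmod (F (\<psi> z)))"
            using \<omega> norm_triangle_ineq4[of "u z * F (\<phi> z)" "v z * F (\<psi> z)"]
            by (intro mult_left_mono) (auto simp: norm_mult)
          also have "\<dots> = (\<omega> * cmod (u z)) * cmod (F (\<phi> z)) + (\<omega> * cmod (v z)) * cmod (F (\<psi> z))"
            by (simp add: algebra_simps)
          also have "\<dots> \<le> U * e' + V * e'"
            using \<omega> U V F self'[OF z] by (intro add_mono mult_mono) auto
          finally show "(1 - (norm z)\<^sup>2) powr \<beta> * cmod (\<sigma> (k m) z - \<sigma> (k n) z) \<le> (U + V) * e'"
            by (simp add: eq \<omega>_def algebra_simps)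
        qed
        then show ?thesis
          using e'(1) e'_le U V by (simp add: wnorm_eq_Hdist[OF \<sigma> \<sigma>] ennreal_le_iff)
      qed
      then show ?thesis by auto
    qed
    then have "Y.MCauchy (\<sigma> \<circ> k)"
      using \<sigma> by (auto simp: Y.MCauchy_def)
    then show "\<exists>r. strict_mono r \<and> Y.MCauchy (\<sigma> \<circ> r)"
      using k(1) by blast
  qed
  then have "compactin Y.mtopology (Y.mtopology closure_of ?K ` {f \<in> Hinf \<alpha>. wnorm \<alpha> f \<le> 1})"
    using Y.mtotally_bounded_eq_compact_closure_of[OF mcomplete_Hinf[OF ab(2)]] by simp
  then show ?thesis
    using lin by (simp add: compact_op_def Let_def)
qed

section \<open>Compact operators on null sequences\<close>
lemma linear_op_add:
  assumes "linear_op \<alpha> \<beta> K" "f \<in> Hinf \<alpha>" "g \<in> Hinf \<alpha>"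
  shows "K (\<lambda>z. f z + g z) = (\<lambda>z. K f z + K g z)"
proof -
  have "\<forall>f\<in>Hinf \<alpha>. \<forall>g\<in>Hinf \<alpha>. K (\<lambda>z. f z + g z) = (\<lambda>z. K f z + K g z)"
    using assms(1) by (simp add: linear_op_def)
  from this[rule_format, OF assms(2,3)] show ?thesis .
qed

lemma linear_op_cmult:
  assumes "linear_op \<alpha> \<beta> K" "f \<in> Hinf \<alpha>"
  shows "K (\<lambda>z. c * f z) = (\<lambda>z. c * K f z)"
proof -
  have "\<forall>f\<in>Hinf \<alpha>. \<forall>c. K (\<lambda>z. c * f z) = (\<lambda>z. c * K f z)"
    using assms(1) by (simp add: linear_op_def)
  from this[rule_format, OF assms(2)] show ?thesis .
qed

lemma compact_op_bounded:
  assumes "compact_op \<alpha> \<beta> K"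
  obtains B where "0 \<le> B"
    "\<And>f c. f \<in> Hinf \<alpha> \<Longrightarrow> 0 < c \<Longrightarrow> wnorm \<alpha> f \<le> ennreal c \<Longrightarrow> wnorm \<beta> (K f) \<le> ennreal (c * B)"
proof -
  interpret Y: Metric_space "Hinf \<beta> :: (complex ^ 'a \<Rightarrow> complex) set" "Hdist \<beta>"
    by (rule Metric_space_Hinf)
  let ?S = "K ` {f \<in> Hinf \<alpha>. wnorm \<alpha> f \<le> 1}"
  have lin: "linear_op \<alpha> \<beta> K" and comp: "compactin Y.mtopology (Y.mtopology closure_of ?S)"
    using assms by (auto simp: compact_op_def Let_def)
  have KH: "K f \<in> Hinf \<beta>" if "f \<in> Hinf \<alpha>" for f
    using lin that by (auto simp: linear_op_def)
  have "?S \<subseteq> Y.mtopology closure_of ?S"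
    using KH by (intro closure_of_subset) auto
  moreover obtain x R where x: "Y.mtopology closure_of ?S \<subseteq> Y.mcball x R"
    using Y.compactin_imp_mbounded[OF comp] by (auto simp: Y.mbounded_def)
  ultimately have S: "?S \<subseteq> Y.mcball x R"
    by blast
  have 0: "(\<lambda>z. 0) \<in> Hinf \<alpha>" "wnorm \<alpha> (\<lambda>z::complex ^ 'a. 0) \<le> 1"
    by (rule Hinf_zero) (simp add: wnorm_def)
  have xH: "x \<in> Hinf \<beta>" and R: "0 \<le> R"
  proof -
    have *: "K (\<lambda>z. 0) \<in> Y.mcball x R"
      using S 0 by blast
    then show "x \<in> Hinf \<beta>"
      by (simp add: Y.in_mcball)
    have "Hdist \<beta> x (K (\<lambda>z. 0)) \<le> R"
      using * by (simp add: Y.in_mcball)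
    then show "0 \<le> R"
      using Hdist_nonneg[of \<beta> x "K (\<lambda>z. 0)"] by linarith
  qed
  obtain X where X: "0 \<le> X" "wnorm \<beta> x = ennreal X"
    using Hinf_real_bound[OF xH] .
  have unit: "wnorm \<beta> (K f) \<le> ennreal (X + R)" if "f \<in> Hinf \<alpha>" "wnorm \<alpha> f \<le> 1" for f
  proof -
    have "Hdist \<beta> x (K f) \<le> R"
      using S that by auto
    then have "wnorm \<beta> (\<lambda>z. x z - K f z) \<le> ennreal R"
      by (simp add: wnorm_eq_Hdist[OF xH KH[OF that(1)]] ennreal_leI)
    then have "wnorm \<beta> (\<lambda>z. x z - (x z - K f z)) \<le> ennreal X + ennreal R"
      using X by (intro order_trans[OF wnorm_diff[of \<beta> x "\<lambda>z. x z - K f z"]] add_mono) auto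
    then show ?thesis
      using X R by simp
  qed
  show thesis
  proof (rule that[of "X + R"])
    show "0 \<le> X + R"
      using X R by simp
    fix f :: "complex ^ 'a \<Rightarrow> complex" and c :: real
    assume f: "f \<in> Hinf \<alpha>" and c: "0 < c" "wnorm \<alpha> f \<le> ennreal c"
    define g where "g = (\<lambda>z. of_real (1 / c) * f z)"
    have g: "g \<in> Hinf \<alpha>"
      unfolding g_def by (rule Hinf_cmult[OF f])
    have "wnorm \<alpha> g \<le> ennreal (1 / c) * ennreal c"
      unfolding g_def wnorm_cmult using c by (auto simp: norm_divide intro!: mult_left_mono)
    also have "\<dots> = 1"
      using c(1) by (simp flip: ennreal_mult)
    finally have g1: "wnorm \<alpha> g \<le> 1" .
    have "K (\<lambda>z. of_real c * g z) = (\<lambda>z. of_real c * K g z)"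
      by (rule linear_op_cmult[OF lin g])
    moreover have "(\<lambda>z. of_real c * g z) = f"
      using c(1) by (simp add: g_def)
    ultimately have "wnorm \<beta> (K f) = ennreal c * wnorm \<beta> (K g)"
      using c(1) by (simp add: wnorm_cmult)
    also have "\<dots> \<le> ennreal c * ennreal (X + R)"
      by (intro mult_left_mono unit g g1) auto
    also have "\<dots> = ennreal (c * (X + R))"
      using c(1) X R by (simp add: ennreal_mult)
    finally show "wnorm \<beta> (K f) \<le> ennreal (c * (X + R))" .
  qed
qed

lemma linear_op_sum:
  fixes F :: "'i \<Rightarrow> complex ^ 'n \<Rightarrow> complex"
  assumes K: "linear_op \<alpha> \<beta> K" and I: "finite I" and F: "\<And>i. i \<in> I \<Longrightarrow> F i \<in> Hinf \<alpha>"
  shows "K (\<lambda>z. \<Sum>i\<in>I. F i z) = (\<lambda>z. \<Sum>i\<in>I. K (F i) z)"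
  using I F
proof (induction rule: finite_induct)
  case empty
  from linear_op_cmult[OF K Hinf_zero, of 0] show ?case by simp
next
  case (insert i I)
  have "K (\<lambda>z. F i z + (\<Sum>i\<in>I. F i z)) = (\<lambda>z. K (F i) z + K (\<lambda>z. \<Sum>i\<in>I. F i z) z)"
    using insert.prems Hinf_sum[OF insert.hyps(1), of F \<alpha>] by (intro linear_op_add[OF K]) auto
  then show ?case
    using insert by simp
qed

text \<open>Each function, being bounded, has weight tending to zero at the sphere, while the sequence
  tends to zero inside. A new member can thus be chosen to be at most \<open>2^-(n+1)\<close> on
  a smaller ball outside which the weighted sum of the old ones is at most 1; there the new weighted
  sum is at most 2. The bound \<open>4 - 2^-n\<close> makes the induction close.\<close>
lemma gliding_hump:
  fixes F :: "nat \<Rightarrow> complex ^ 'n \<Rightarrow> complex"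
  assumes \<alpha>: "0 < \<alpha>"
    and norm: "\<And>k. wnorm \<alpha> (F k) \<le> 1"
    and bdd: "\<And>k. \<exists>b. \<forall>z. norm z < 1 \<longrightarrow> cmod (F k z) \<le> b"
    and null: "\<And>r e. r < 1 \<Longrightarrow> 0 < e \<Longrightarrow> \<exists>N. \<forall>k\<ge>N. \<forall>z. norm z \<le> r \<longrightarrow> cmod (F k z) \<le> e"
  shows "\<exists>I. finite I \<and> card I = n \<and> I \<subseteq> {i0..} \<and>
    (\<forall>z. norm z < 1 \<longrightarrow> (1 - (norm z)\<^sup>2) powr \<alpha> * (\<Sum>i\<in>I. cmod (F i z)) \<le> 4 - (1/2) ^ n)"
proof (induction n)
  case 0
  show ?case by (rule exI[of _ "{}"]) auto
next
  case (Suc n)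
  then obtain I where I: "finite I" "card I = n" "I \<subseteq> {i0..}"
    "\<And>z. norm z < 1 \<Longrightarrow> (1 - (norm z)\<^sup>2) powr \<alpha> * (\<Sum>i\<in>I. cmod (F i z)) \<le> 4 - (1/2) ^ n"
    by blast
  obtain b where b: "\<And>k z. norm z < 1 \<Longrightarrow> cmod (F k z) \<le> b k"
    using bdd by metis
  define B where "B = (\<Sum>i\<in>I. b i)"
  have b0: "0 \<le> b k" for k
    using order_trans[OF norm_ge_zero b[of 0 k]] by simp
  have B0: "0 \<le> B" and B: "\<And>z. norm z < 1 \<Longrightarrow> (\<Sum>i\<in>I. cmod (F i z)) \<le> B"
    using b b0 by (auto simp: B_def intro!: sum_nonneg sum_mono)
  \<comment> \<open>Where \<open>1 - |z|\<^sup>2 \<le> t\<close> the weight is at most \<open>1 / (B + 1)\<close>.\<close>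
  define t where "t = (B + 1) powr (-1 / \<alpha>)"
  have t: "0 < t" "t powr \<alpha> = 1 / (B + 1)"
  proof -
    show "0 < t"
      using B0 by (simp add: t_def)
    have "t powr \<alpha> = (B + 1) powr -1"
      unfolding t_def powr_powr using \<alpha> by simp
    then show "t powr \<alpha> = 1 / (B + 1)"
      using B0 by (simp add: powr_minus_divide)
  qed
  have t1: "t \<le> 1"
    unfolding t_def using B0 \<alpha> powr_mono[of "-1 / \<alpha>" 0 "B + 1"] by simp
  define r where "r = sqrt (1 - t)"
  have r: "0 \<le> r" "r < 1" "r\<^sup>2 = 1 - t"
    using t t1 by (auto simp: r_def)
  obtain N where N: "\<And>k z. k \<ge> N \<Longrightarrow> norm z \<le> r \<Longrightarrow> cmod (F k z) \<le> (1/2) ^ Suc n"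
    using null[OF r(2), of "(1/2) ^ Suc n"] by auto
  define k where "k = max N (Suc (Max (insert i0 I)))"
  have k: "k \<ge> N" "k \<notin> I" "k \<ge> i0"
  proof -
    have "i < k" if "i \<in> insert i0 I" for i
    proof -
      have "i \<le> Max (insert i0 I)"
        using I(1) that by (intro Max_ge) auto
      then show ?thesis
        unfolding k_def by (simp only: less_max_iff_disj less_Suc_eq_le simp_thms)
    qed
    then show "k \<notin> I" "k \<ge> i0"
      by (auto intro: less_imp_le)
  qed (simp add: k_def)
  have "(1 - (norm z)\<^sup>2) powr \<alpha> * (\<Sum>i\<in>insert k I. cmod (F i z)) \<le> 4 - (1/2) ^ Suc n"
    if z: "norm z < 1" for z
  proof -
    define w where "w = (1 - (norm z)\<^sup>2) powr \<alpha>"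
    have w: "0 \<le> w" "w \<le> 1"
      using weight_pos[OF z] powr_mono2[of \<alpha> "1 - (norm z)\<^sup>2" 1] \<alpha> by (auto simp: w_def)
    have split: "w * (\<Sum>i\<in>insert k I. cmod (F i z)) = w * cmod (F k z) + w * (\<Sum>i\<in>I. cmod (F i z))"
      using I(1) k(2) by (simp add: algebra_simps)
    have pow: "(0::real) < (1/2) ^ n" "(1/2) ^ n \<le> (1::real)"
      by (auto intro: power_le_one)
    show ?thesis
    proof (cases "norm z \<le> r")
      case True
      have "w * cmod (F k z) \<le> 1 * (1/2) ^ Suc n"
        using w N[OF k(1) True] by (intro mult_mono) auto
      then show ?thesis
        using I(4)[OF z] split by (simp add: w_def)
    next
      case False
      have "1 - (norm z)\<^sup>2 \<le> t"
        using power_mono[of r "norm z" 2] r False by simp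
      then have "w \<le> 1 / (B + 1)"
        unfolding w_def t(2)[symmetric] using weight_pos[OF z] \<alpha> by (intro powr_mono2) auto
      then have "w * (\<Sum>i\<in>I. cmod (F i z)) \<le> 1 / (B + 1) * B"
        using B[OF z] w B0 by (intro mult_mono) (auto intro: sum_nonneg)
      also have "\<dots> \<le> 1"
        using B0 by (simp add: field_simps)
      finally have "w * (\<Sum>i\<in>I. cmod (F i z)) \<le> 1" .
      moreover have "w * cmod (F k z) \<le> 1"
        unfolding w_def using norm[of k] z by (intro wnorm_leD) auto
      ultimately show ?thesis
        using split pow by (simp add: w_def)
    qed
  qed
  then show ?case
    using I(1-3) k by (intro exI[of _ "insert k I"]) auto
qed

text \<open>If the images did not tend to zero, compactness would give a subsequence whose images converge
  to some \<open>l\<close> with \<open>l z0 \<noteq> 0\<close>. The image of a sum of \<open>n\<close> members of that subsequence then has size about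
  \<open>n |l z0|\<close> at \<open>z0\<close>, although the sum itself can be chosen with norm at most 4.\<close>
proposition compact_op_vanishes:
  fixes F :: "nat \<Rightarrow> complex ^ 'n \<Rightarrow> complex"
  assumes \<alpha>: "0 < \<alpha>" and K: "compact_op \<alpha> \<beta> K"
    and F: "\<And>k. F k \<in> Hinf \<alpha>" "\<And>k. wnorm \<alpha> (F k) \<le> 1"
    and bdd: "\<And>k. \<exists>b. \<forall>z. norm z < 1 \<longrightarrow> cmod (F k z) \<le> b"
    and null: "\<And>r e. r < 1 \<Longrightarrow> 0 < e \<Longrightarrow> \<exists>N. \<forall>k\<ge>N. \<forall>z. norm z \<le> r \<longrightarrow> cmod (F k z) \<le> e"
    and e: "0 < e"
  shows "\<exists>N. \<forall>k\<ge>N. wnorm \<beta> (K (F k)) \<le> ennreal e"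
proof (rule ccontr)
  assume contra: "\<not> ?thesis"
  interpret Y: Metric_space "Hinf \<beta> :: (complex ^ 'n \<Rightarrow> complex) set" "Hdist \<beta>"
    by (rule Metric_space_Hinf)
  let ?S = "K ` {f \<in> Hinf \<alpha>. wnorm \<alpha> f \<le> 1}"
  have lin: "linear_op \<alpha> \<beta> K" and comp: "compactin Y.mtopology (Y.mtopology closure_of ?S)"
    using K by (auto simp: compact_op_def Let_def)
  have KH: "K f \<in> Hinf \<beta>" if "f \<in> Hinf \<alpha>" for f
    using lin that by (auto simp: linear_op_def)
  have cl: "?S \<subseteq> Y.mtopology closure_of ?S"
    using KH by (intro closure_of_subset) auto
  define A where "A = {k. \<not> wnorm \<beta> (K (F k)) \<le> ennreal e}"
  have A: "infinite A"
    using contra unfolding A_def infinite_nat_iff_unbounded_le by blast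
  define a where "a = enumerate A"
  have a: "strict_mono a" "\<And>k. a k \<in> A"
    using A by (auto simp: a_def strict_mono_enumerate enumerate_in_set)
  have sub: "range (\<lambda>k. K (F (a k))) \<subseteq> Y.mtopology closure_of ?S"
    using F cl by blast
  have "\<forall>\<sigma>::nat \<Rightarrow> _. range \<sigma> \<subseteq> Y.mtopology closure_of ?S \<longrightarrow>
      (\<exists>l r. l \<in> Y.mtopology closure_of ?S \<and> strict_mono r \<and> limitin Y.mtopology (\<sigma> \<circ> r) l sequentially)"
    using comp unfolding Y.compactin_sequentially by (rule conjunct2)
  from this[rule_format, OF sub]
  obtain l and r :: "nat \<Rightarrow> nat" where r: "strict_mono r"
    and lim: "limitin Y.mtopology ((\<lambda>k. K (F (a k))) \<circ> r) l sequentially"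
    by (elim exE conjE) rule
  define b where "b = a \<circ> r"
  have b: "strict_mono b"
    unfolding b_def by (rule strict_mono_o[OF a(1) r])
  have l: "l \<in> Hinf \<beta>"
    and bl: "\<And>\<epsilon>. 0 < \<epsilon> \<Longrightarrow> \<exists>N. \<forall>n\<ge>N. Hdist \<beta> (K (F (b n))) l < \<epsilon>"
    using lim unfolding Y.limit_metric_sequentially b_def comp_def by blast+
  obtain n1 where n1: "Hdist \<beta> (K (F (b n1))) l < e"
    using bl[OF e] by blast
  have "wnorm \<beta> l \<noteq> 0"
  proof
    assume "wnorm \<beta> l = 0"
    then have "wnorm \<beta> (K (F (b n1))) \<le> ennreal (Hdist \<beta> (K (F (b n1))) l)"
      using wnorm_triangle[of \<beta> "\<lambda>z. K (F (b n1)) z - l z" l]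
      by (simp add: wnorm_eq_Hdist[OF KH[OF F(1)] l])
    also have "\<dots> \<le> ennreal e"
      using n1 by (intro ennreal_leI) simp
    finally show False
      using a(2)[of "r n1"] by (simp add: A_def b_def)
  qed
  then obtain z0 where z0: "norm z0 < 1" "l z0 \<noteq> 0"
    unfolding wnorm_eq_0_iff by auto
  define w where "w = (1 - (norm z0)\<^sup>2) powr \<beta>"
  have w: "0 < w"
    using weight_pos[OF z0(1)] by (simp add: w_def)
  define L where "L = cmod (l z0)"
  have L: "0 < L"
    using z0 by (simp add: L_def)
  obtain i0 where i0: "\<And>i. i \<ge> i0 \<Longrightarrow> Hdist \<beta> (K (F (b i))) l < w * (L / 2)"
    using bl[of "w * (L / 2)"] w L by auto
  have near: "cmod (K (F (b i)) z0 - l z0) \<le> L / 2" if "i \<ge> i0" for i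
  proof -
    have "wnorm \<beta> (\<lambda>z. K (F (b i)) z - l z) \<le> ennreal (w * (L / 2))"
      using i0[OF that] by (simp add: wnorm_eq_Hdist[OF KH[OF F(1)] l] ennreal_leI)
    from wnorm_leD[OF this _ z0(1)] show ?thesis
      using w L by (simp flip: w_def)
  qed
  obtain B where B: "0 \<le> B"
    "\<And>f c. f \<in> Hinf \<alpha> \<Longrightarrow> 0 < c \<Longrightarrow> wnorm \<alpha> f \<le> ennreal c \<Longrightarrow> wnorm \<beta> (K f) \<le> ennreal (c * B)"
    using compact_op_bounded[OF K] by metis
  obtain n :: nat where n: "4 * B / (w * (L / 2)) < n"
    using reals_Archimedean2 by blast
  have "\<exists>I. finite I \<and> card I = n \<and> I \<subseteq> {i0..} \<and>
    (\<forall>z. norm z < 1 \<longrightarrow> (1 - (norm z)\<^sup>2) powr \<alpha> * (\<Sum>i\<in>I. cmod (F (b i) z)) \<le> 4 - (1/2) ^ n)"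
  proof (rule gliding_hump[OF \<alpha>])
    fix r e :: real assume "r < 1" "0 < e"
    then obtain N where N: "\<And>k z. k \<ge> N \<Longrightarrow> norm z \<le> r \<Longrightarrow> cmod (F k z) \<le> e"
      using null by blast
    then show "\<exists>N. \<forall>k\<ge>N. \<forall>z. norm z \<le> r \<longrightarrow> cmod (F (b k) z) \<le> e"
      using strict_mono_imp_increasing[OF b] by (meson order_trans)
  qed (use F bdd in auto)
  then obtain I where I: "finite I" "card I = n" "I \<subseteq> {i0..}"
    "\<And>z. norm z < 1 \<Longrightarrow> (1 - (norm z)\<^sup>2) powr \<alpha> * (\<Sum>i\<in>I. cmod (F (b i) z)) \<le> 4 - (1/2) ^ n"
    by blast
  define f where "f = (\<lambda>z. \<Sum>i\<in>I. F (b i) z)"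
  have f: "f \<in> Hinf \<alpha>"
    unfolding f_def by (rule Hinf_sum[OF I(1) F(1)])
  have "wnorm \<alpha> f \<le> ennreal 4"
  proof (rule wnorm_leI)
    fix z :: "complex ^ 'n" assume z: "norm z < 1"
    have "(1 - (norm z)\<^sup>2) powr \<alpha> * cmod (f z) \<le> (1 - (norm z)\<^sup>2) powr \<alpha> * (\<Sum>i\<in>I. cmod (F (b i) z))"
      unfolding f_def by (intro mult_left_mono norm_sum) auto
    also have "\<dots> \<le> 4"
      using I(4)[OF z] by (rule order_trans) simp
    finally show "(1 - (norm z)\<^sup>2) powr \<alpha> * cmod (f z) \<le> 4" .
  qed
  then have "wnorm \<beta> (K f) \<le> ennreal (4 * B)"
    by (intro B(2) f) auto
  then have upper: "w * cmod (K f z0) \<le> 4 * B"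
    unfolding w_def using B(1) z0(1) by (intro wnorm_leD) auto
  have Kf: "K f z0 = (\<Sum>i\<in>I. K (F (b i)) z0)"
    unfolding f_def using linear_op_sum[OF lin I(1) F(1)] by meson
  have "n * L = cmod (\<Sum>i\<in>I. l z0)"
    using I(2) by (simp add: L_def norm_mult)
  also have "\<dots> = cmod (K f z0 - (\<Sum>i\<in>I. K (F (b i)) z0 - l z0))"
    by (simp add: Kf sum_subtractf)
  also have "\<dots> \<le> cmod (K f z0) + cmod (\<Sum>i\<in>I. K (F (b i)) z0 - l z0)"
    by (rule norm_triangle_ineq4)
  also have "cmod (\<Sum>i\<in>I. K (F (b i)) z0 - l z0) \<le> n * (L / 2)"
    using sum_norm_bound[of I "\<lambda>i. K (F (b i)) z0 - l z0" "L / 2"] near I by auto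
  finally have "w * (n * (L / 2)) \<le> w * cmod (K f z0)"
    using w by (intro mult_left_mono) auto
  then have "n * (w * (L / 2)) \<le> 4 * B"
    using upper by (simp add: mult_ac)
  moreover have "4 * B < n * (w * (L / 2))"
    using n w L by (simp add: pos_divide_less_eq)
  ultimately show False by simp
qed

section \<open>The lower bound for the essential norm\<close>

text \<open>The two upper limits of the theorem are the cases \<open>G j \<xi> = \<langle>z,\<xi>\<rangle>^j\<close> and
  \<open>G j (\<xi>,\<xi>') = \<langle>z,\<xi>\<rangle>^j \<langle>z,\<xi>'\<rangle>\<close>. The assumptions say that after normalisation the functions tend to
  zero on \<open>|z| \<le> r\<close> like \<open>(r/s)^j\<close> for some \<open>s\<close> between \<open>r\<close> and 1, uniformly in the parameter. For
  each \<open>j\<close> a parameter that almost attains the supremum is picked, and a compact operator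
  is applied to the resulting sequence.\<close>
proposition limsup_test_functions_le_ess_norm:
  fixes G :: "nat \<Rightarrow> 'p \<Rightarrow> complex ^ 'n \<Rightarrow> complex"
  assumes \<alpha>: "0 < \<alpha>"
    and self: "holo_self_map \<phi>" "holo_self_map \<psi>"
    and holo: "\<And>j p. p \<in> P \<Longrightarrow> holo_ball (G j p)"
    and upper: "\<And>j p z. p \<in> P \<Longrightarrow> norm z < 1 \<Longrightarrow> cmod (G j p z) \<le> norm z ^ j"
    and lower: "\<And>s. 0 < s \<Longrightarrow> s < 1 \<Longrightarrow>
      \<exists>c>0. \<forall>j. \<forall>p\<in>P. ennreal (c * s ^ j) \<le> wnorm \<alpha> (G j p)"
  shows "limsup (\<lambda>j. SUP p\<in>P. wnorm \<beta> (\<lambda>z. u z * G j p (\<phi> z) - v z * G j p (\<psi> z)) / wnorm \<alpha> (G j p))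
    \<le> ess_norm \<alpha> \<beta> (\<lambda>f z. wcomp u \<phi> f z - wcomp v \<psi> f z)"
proof (cases "P = {}")
  case True
  then show ?thesis
    by (simp add: bot_ennreal Limsup_const)
next
  case False
  then obtain p0 where p0: "p0 \<in> P" by blast
  define T where "T = (\<lambda>f z. wcomp u \<phi> f z - wcomp v \<psi> f z)"
  define ratio where "ratio = (\<lambda>j p. wnorm \<beta> (\<lambda>z. u z * G j p (\<phi> z) - v z * G j p (\<psi> z)) / wnorm \<alpha> (G j p))"
  have self': "norm (\<phi> z) < 1" "norm (\<psi> z) < 1" if "norm z < 1" for z
    using self that by (simp_all add: holo_self_map_norm)
  have G1: "wnorm \<alpha> (G j p) \<le> 1" if "p \<in> P" for j p
  proof -
    have "wnorm \<alpha> (G j p) \<le> ennreal 1"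
    proof (rule wnorm_leI)
      fix z :: "complex ^ 'n" assume z: "norm z < 1"
      have "(1 - (norm z)\<^sup>2) powr \<alpha> \<le> 1"
        using weight_pos[OF z] powr_mono2[of \<alpha> "1 - (norm z)\<^sup>2" 1] \<alpha> by simp
      moreover have "cmod (G j p z) \<le> 1"
        using order_trans[OF upper[OF that z] power_le_one[of "norm z" j]] z by simp
      ultimately show "(1 - (norm z)\<^sup>2) powr \<alpha> * cmod (G j p z) \<le> 1"
        by (intro mult_le_one) auto
    qed
    then show ?thesis by simp
  qed
  have "limsup (\<lambda>j. SUP p\<in>P. ratio j p) \<le> op_norm \<alpha> \<beta> (\<lambda>f z. T f z - K f z)"
    if K: "compact_op \<alpha> \<beta> K" for K
    unfolding Limsup_le_iff
  proof (intro allI impI)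
    fix y assume y: "op_norm \<alpha> \<beta> (\<lambda>f z. T f z - K f z) < y"
    then obtain b where b: "op_norm \<alpha> \<beta> (\<lambda>f z. T f z - K f z) < b" "b < y"
      using dense by blast
    define V where "V = enn2real (op_norm \<alpha> \<beta> (\<lambda>f z. T f z - K f z))"
    have V: "op_norm \<alpha> \<beta> (\<lambda>f z. T f z - K f z) = ennreal V" "0 \<le> V"
      using less_le_trans[OF b(1) top_greatest] by (simp_all add: V_def)
    define b' where "b' = enn2real b"
    have b': "b = ennreal b'"
      using less_le_trans[OF b(2) top_greatest] by (simp add: b'_def)
    have b'V: "V < b'"
      using b(1) unfolding V(1) b' by (simp add: ennreal_less_iff V(2))
    have "\<forall>j. \<exists>p\<in>P. ratio j p > b \<or> (\<forall>q\<in>P. ratio j q \<le> b)"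
      using p0 by (meson linorder_not_le)
    then obtain p where p: "\<And>j. p j \<in> P" "\<And>j. ratio j (p j) > b \<or> (\<forall>q\<in>P. ratio j q \<le> b)"
      by metis
    define N where "N = (\<lambda>j. enn2real (wnorm \<alpha> (G j (p j))))"
    have N: "wnorm \<alpha> (G j (p j)) = ennreal (N j)" for j
      using le_less_trans[OF G1[OF p(1)], of top] by (simp add: N_def)
    have Nlow: "\<exists>c>0. \<forall>j. c * s ^ j \<le> N j" if s: "0 < s" "s < 1" for s
    proof -
      obtain c where c: "c > 0" "\<And>j. ennreal (c * s ^ j) \<le> wnorm \<alpha> (G j (p j))"
        using lower[OF s] p(1) by blast
      have "c * s ^ j \<le> N j" for j
        using c(2)[of j] unfolding N by (subst (asm) ennreal_le_iff) (simp_all add: N_def)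
      then show ?thesis
        using c(1) by blast
    qed
    have Npos: "0 < N j" for j
    proof -
      obtain c where "c > 0" "c * (1/2) ^ j \<le> N j"
        using Nlow[of "1/2"] by auto
      then show ?thesis
        by (smt (verit) half_gt_zero_iff zero_less_mult_iff zero_less_power)
    qed
    define F where "F = (\<lambda>j z. if norm z < 1 then of_real (1 / N j) * G j (p j) z else 0)"
    have wF: "wnorm \<alpha> (F j) = 1" for j
    proof -
      have "wnorm \<alpha> (F j) = wnorm \<alpha> (\<lambda>z. of_real (1 / N j) * G j (p j) z)"
        by (rule wnorm_cong) (simp add: F_def)
      also have "\<dots> = ennreal (1 / N j) * ennreal (N j)"
        unfolding wnorm_cmult N using Npos[of j] by (simp add: norm_divide)
      also have "\<dots> = 1"
        using Npos[of j] by (simp flip: ennreal_mult)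
      finally show ?thesis .
    qed
    have F: "F j \<in> Hinf \<alpha>" for j
    proof (rule HinfI)
      show "holo_ball (F j)"
        by (rule holo_ball_cong[OF holo_ball_mult[OF holo_ball_const[of "of_real (1 / N j)"] holo[OF p(1), of j j]]])
          (simp add: F_def)
    qed (auto simp: wF, simp add: F_def)
    have Fle: "cmod (F j z) \<le> norm z ^ j / N j" if "norm z < 1" for j z
      using that upper[OF p(1) that] Npos[of j]
      by (simp add: F_def norm_mult norm_divide divide_right_mono)
    have null: "\<exists>M. \<forall>j\<ge>M. \<forall>z. norm z \<le> r \<longrightarrow> cmod (F j z) \<le> e" if r: "r < 1" and e: "0 < e" for r e
    proof (cases "0 \<le> r")
      case False
      then show ?thesis
        by (meson norm_ge_zero order_trans)
    next
      case True
      define s where "s = (1 + r) / 2"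
      have s: "r < s" "s < 1" "0 < s"
        using r True by (auto simp: s_def)
      obtain c where c: "c > 0" "\<And>j. c * s ^ j \<le> N j"
        using Nlow[OF s(3,2)] by blast
      have "(\<lambda>j. (r / s) ^ j) \<longlonglongrightarrow> 0"
        using s True by (intro LIMSEQ_realpow_zero) auto
      then have "\<forall>\<^sub>F j in sequentially. (r / s) ^ j < c * e"
        using c e by (intro order_tendstoD) auto
      then obtain M where M: "\<And>j. j \<ge> M \<Longrightarrow> (r / s) ^ j < c * e"
        by (auto simp: eventually_sequentially)
      have "cmod (F j z) \<le> e" if "j \<ge> M" "norm z \<le> r" for j z
      proof -
        have "cmod (F j z) \<le> norm z ^ j / N j"
          using that r by (intro Fle) auto
        also have "\<dots> \<le> r ^ j / (c * s ^ j)"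
          using that c s True by (intro frac_le power_mono) auto
        also have "\<dots> = (r / s) ^ j / c"
          by (simp add: power_divide)
        also have "\<dots> \<le> e"
          using less_imp_le[OF M[OF that(1)]] c(1) by (simp only: pos_divide_le_eq mult.commute)
        finally show ?thesis .
      qed
      then show ?thesis by blast
    qed
    have "\<exists>M. \<forall>k\<ge>M. wnorm \<beta> (K (F k)) \<le> ennreal (b' - V)"
    proof (rule compact_op_vanishes[OF \<alpha> K F _ _ null])
      show "\<exists>b. \<forall>z. norm z < 1 \<longrightarrow> cmod (F k z) \<le> b" for k
      proof (intro exI allI impI)
        fix z :: "complex ^ 'n" assume z: "norm z < 1"
        have "norm z ^ k / N k \<le> 1 / N k"
          using z Npos[of k] by (intro divide_right_mono power_le_one) auto
        then show "cmod (F k z) \<le> 1 / N k"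
          using Fle[OF z, of k] by linarith
      qed
    qed (use b'V wF in auto)
    then obtain M where M: "\<And>j. j \<ge> M \<Longrightarrow> wnorm \<beta> (K (F j)) \<le> ennreal (b' - V)"
      by blast
    have ratio: "ratio j (p j) = wnorm \<beta> (T (F j))" for j
    proof -
      have "ratio j (p j) = ennreal (1 / N j) * wnorm \<beta> (\<lambda>z. u z * G j (p j) (\<phi> z) - v z * G j (p j) (\<psi> z))"
        unfolding ratio_def N using Npos[of j]
        by (simp add: divide_ennreal_def inverse_ennreal mult.commute inverse_eq_divide)
      also have "\<dots> = wnorm \<beta> (\<lambda>z. of_real (1 / N j) * (u z * G j (p j) (\<phi> z) - v z * G j (p j) (\<psi> z)))"
        unfolding wnorm_cmult using Npos[of j] by (simp add: norm_divide)
      also have "\<dots> = wnorm \<beta> (T (F j))"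
        by (rule wnorm_cong) (simp add: T_def F_def wcomp_def self' algebra_simps diff_divide_distrib)
      finally show ?thesis .
    qed
    have "(SUP q\<in>P. ratio j q) < y" if "j \<ge> M" for j
    proof -
      have "ratio j (p j) \<le> wnorm \<beta> (\<lambda>z. T (F j) z - K (F j) z) + wnorm \<beta> (K (F j))"
        using wnorm_triangle[of \<beta> "\<lambda>z. T (F j) z - K (F j) z" "K (F j)"] by (simp add: ratio)
      also have "\<dots> \<le> ennreal V + ennreal (b' - V)"
      proof (rule add_mono[OF _ M[OF that]])
        show "wnorm \<beta> (\<lambda>z. T (F j) z - K (F j) z) \<le> ennreal V"
          unfolding V(1)[symmetric] op_norm_def using F[of j] wF[of j]
          by (intro SUP_upper2[of "F j"]) auto
      qed
      also have "\<dots> = b"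
        using b' b'V V(2) by (simp flip: ennreal_plus)
      finally have "\<forall>q\<in>P. ratio j q \<le> b"
        using p(2)[of j] by (auto simp: not_le[symmetric])
      then have "(SUP q\<in>P. ratio j q) \<le> b"
        by (auto intro: SUP_least)
      then show ?thesis
        using b(2) by (rule le_less_trans)
    qed
    then show "\<forall>\<^sub>F j in sequentially. (SUP p\<in>P. ratio j p) < y"
      by (auto simp: eventually_sequentially)
  qed
  then have "limsup (\<lambda>j. SUP p\<in>P. ratio j p) \<le> ess_norm \<alpha> \<beta> T"
    unfolding ess_norm_def by (intro INF_greatest) simp
  then show ?thesis
    by (simp only: ratio_def T_def)
qed

section \<open>What the powers of a linear form detect\<close>

text \<open>With \<open>t = 1 - x\<^sup>2\<close> the left-hand side is at most \<open>t^\<alpha> exp(-t i/2)\<close>, and the bound is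
  \<open>\<tau> \<le> exp \<tau>\<close> for \<open>\<tau> = t i/(2\<alpha>)\<close>, raised to the power \<open>\<alpha>\<close>.\<close>
lemma power_weight_le:
  fixes x \<alpha> :: real
  assumes "0 \<le> x" "x < 1" "0 < \<alpha>" "1 \<le> i"
  shows "(1 - x\<^sup>2) powr \<alpha> * x ^ i \<le> (2 * \<alpha> / i) powr \<alpha>"
proof -
  define t where "t = 1 - x\<^sup>2"
  have t: "0 < t"
    using assms by (simp add: t_def abs_square_less_1)
  have "x\<^sup>2 \<le> (exp (- t / 2))\<^sup>2"
    using exp_ge_add_one_self[of "- t"] by (simp add: t_def power2_eq_square flip: exp_add)
  then have "x \<le> exp (- t / 2)"
    by (rule power2_le_imp_le) simp
  then have xi: "x ^ i \<le> exp (- t / 2) ^ i"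
    using assms by (intro power_mono) auto
  have "t * i / (2 * \<alpha>) \<le> exp (t * i / (2 * \<alpha>))"
    using exp_ge_add_one_self[of "t * i / (2 * \<alpha>)"] by linarith
  then have "t \<le> 2 * \<alpha> / i * exp (t * i / (2 * \<alpha>))"
    using assms by (simp add: field_simps)
  then have "t powr \<alpha> \<le> (2 * \<alpha> / i * exp (t * i / (2 * \<alpha>))) powr \<alpha>"
    using assms t by (intro powr_mono2) auto
  also have "\<dots> = (2 * \<alpha> / i) powr \<alpha> * exp (t * i / 2)"
    using assms by (subst powr_mult) (auto simp: powr_def[of "exp _"])
  finally have "t powr \<alpha> * x ^ i \<le> (2 * \<alpha> / i) powr \<alpha> * exp (t * i / 2) * exp (- t / 2) ^ i"
    using xi assms by (intro mult_mono) auto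
  also have "\<dots> = (2 * \<alpha> / i) powr \<alpha>"
    by (simp add: exp_minus field_simps flip: exp_of_nat_mult)
  finally show ?thesis
    by (simp add: t_def)
qed

lemma wnorm_herm_power_le:
  assumes "norm \<xi> = 1" "0 < \<alpha>" "1 \<le> i"
  shows "wnorm \<alpha> (\<lambda>z. herm z \<xi> ^ i) \<le> ennreal ((2 * \<alpha> / i) powr \<alpha>)"
proof (rule wnorm_leI)
  fix z :: "complex ^ 'a" assume z: "norm z < 1"
  have "cmod (herm z \<xi> ^ i) \<le> norm z ^ i"
    using norm_herm_le[of z \<xi>] assms(1) by (simp add: norm_power power_mono)
  then have "(1 - (norm z)\<^sup>2) powr \<alpha> * cmod (herm z \<xi> ^ i) \<le> (1 - (norm z)\<^sup>2) powr \<alpha> * norm z ^ i"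
    by (intro mult_left_mono) auto
  also have "\<dots> \<le> (2 * \<alpha> / i) powr \<alpha>"
    using z assms by (intro power_weight_le) auto
  finally show "(1 - (norm z)\<^sup>2) powr \<alpha> * cmod (herm z \<xi> ^ i) \<le> (2 * \<alpha> / i) powr \<alpha>" .
qed

text \<open>If no power up to \<open>j\<close> is far from 1, then the geometric sum of the first \<open>j\<close> powers has
  modulus at least \<open>j/2\<close>, and \<open>1 - w^j\<close> is \<open>1 - w\<close> times this sum.\<close>
lemma some_power_far_from_one:
  fixes w :: complex and j :: nat
  obtains m where "m \<le> j" "min 1 (j * cmod (1 - w)) / 2 \<le> cmod (1 - w ^ m)"
proof (cases "\<exists>m\<le>j. 1 / 2 \<le> cmod (1 - w ^ m)")
  case True
  then obtain m where "m \<le> j" "1 / 2 \<le> cmod (1 - w ^ m)" by blast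
  then show thesis
    by (intro that[of m]) auto
next
  case False
  have "j - cmod (\<Sum>m<j. w ^ m) \<le> cmod ((\<Sum>m<j. 1) - (\<Sum>m<j. w ^ m))"
    using norm_triangle_ineq2[of "\<Sum>m<j. 1" "\<Sum>m<j. w ^ m"] by simp
  also have "\<dots> = cmod (\<Sum>m<j. 1 - w ^ m)"
    by (simp add: sum_subtractf)
  also have "\<dots> \<le> j * (1 / 2)"
  proof -
    have "cmod (1 - w ^ m) \<le> 1 / 2" if "m \<in> {..<j}" for m
    proof -
      have "\<not> 1 / 2 \<le> cmod (1 - w ^ m)"
        using False that less_imp_le by blast
      then show ?thesis by linarith
    qed
    then show ?thesis
      using sum_norm_bound[of "{..<j}" "\<lambda>m. 1 - w ^ m" "1 / 2"] by simp
  qed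
  finally have "cmod (1 - w) * (j / 2) \<le> cmod (1 - w) * cmod (\<Sum>m<j. w ^ m)"
    by (intro mult_left_mono) auto
  also have "\<dots> = cmod (1 - w ^ j)"
    by (simp add: one_diff_power_eq norm_mult)
  finally show thesis
    by (intro that[of j]) (auto simp: field_simps)
qed

text \<open>Here \<open>u\<close> and \<open>v\<close> are the values of the weighted multipliers at one point. Put \<open>A = u x^j\<close> and
  \<open>B = v y^j\<close>. Both \<open>A - B\<close> and \<open>A x^m - B y^m\<close> have modulus at most \<open>W\<close>, so each of
  \<open>A (x^m - y^m)\<close> and \<open>B (x^m - y^m)\<close> has modulus at most \<open>2W\<close>, for every \<open>m\<close>. For the first claim, an \<open>m\<close>
  is chosen for which \<open>x^m - y^m\<close> is large; for the second, \<open>m = j\<close> shows that \<open>v\<close> hardly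
  feels the difference between \<open>x^j\<close> and \<open>y^j\<close>.\<close>
lemma coefficient_estimates:
  fixes u v y :: complex and x W \<kappa> :: real
  assumes x: "0 < x" "x < 1" and y: "cmod y \<le> 1" and \<kappa>: "0 < \<kappa>" "\<kappa> \<le> x ^ j"
    and j: "1 \<le> j * (1 - x)"
    and test: "\<And>i. i \<ge> j \<Longrightarrow> cmod (u * of_real x ^ i - v * y ^ i) \<le> W"
  shows "cmod u * min 1 (cmod (of_real x - y) / (1 - x)) \<le> 4 * W / \<kappa>\<^sup>2"
    and "0 < \<kappa>' \<Longrightarrow> \<kappa>' \<le> cmod y ^ j \<Longrightarrow> cmod (u - v) \<le> (1 + 2 / \<kappa>') / \<kappa> * W"
proof -
  have W: "0 \<le> W"
    using order_trans[OF norm_ge_zero test[of j]] by simp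
  define A where "A = u * of_real x ^ j"
  define B where "B = v * y ^ j"
  have AB: "cmod (A - B) \<le> W"
    unfolding A_def B_def by (rule test) simp
  have AB': "cmod (A * of_real x ^ m - B * y ^ m) \<le> W" for m
    using test[of "j + m"] by (simp add: A_def B_def power_add mult_ac)
  have A: "cmod A * cmod (of_real x ^ m - y ^ m) \<le> 2 * W" for m
  proof -
    have "cmod A * cmod (of_real x ^ m - y ^ m) =
        cmod ((A * of_real x ^ m - B * y ^ m) - (A - B) * y ^ m)"
      by (simp add: algebra_simps flip: norm_mult)
    also have "\<dots> \<le> cmod (A * of_real x ^ m - B * y ^ m) + cmod (A - B) * cmod y ^ m"
      by (metis norm_triangle_ineq4 norm_mult norm_power)
    also have "\<dots> \<le> W + W * 1"
      using AB AB' y W by (intro add_mono mult_mono power_le_one) auto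
    finally show ?thesis by simp
  qed
  have B: "cmod B * cmod (of_real x ^ m - y ^ m) \<le> 2 * W" for m
  proof -
    have "cmod B * cmod (of_real x ^ m - y ^ m) =
        cmod ((A * of_real x ^ m - B * y ^ m) - (A - B) * of_real x ^ m)"
      by (simp add: algebra_simps flip: norm_mult)
    also have "\<dots> \<le> cmod (A * of_real x ^ m - B * y ^ m) + cmod (A - B) * x ^ m"
      using x norm_triangle_ineq4[of "A * of_real x ^ m - B * y ^ m" "(A - B) * of_real x ^ m"]
      by (simp add: norm_mult norm_power)
    also have "\<dots> \<le> W + W * 1"
      using AB AB' x W by (intro add_mono mult_mono power_le_one) auto
    finally show ?thesis by simp
  qed
  have uA: "\<kappa> * cmod u \<le> cmod A"
    using mult_right_mono[OF \<kappa>(2), of "cmod u"] x by (simp add: A_def norm_mult norm_power mult.commute)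
  show "cmod u * min 1 (cmod (of_real x - y) / (1 - x)) \<le> 4 * W / \<kappa>\<^sup>2"
  proof -
    define w where "w = y / of_real x"
    obtain m where m: "m \<le> j" "min 1 (j * cmod (1 - w)) / 2 \<le> cmod (1 - w ^ m)"
      by (rule some_power_far_from_one)
    have "\<kappa> \<le> x ^ m"
      using order_trans[OF \<kappa>(2) power_decreasing[OF m(1), of x]] x by simp
    have "cmod (of_real x - y) = x * cmod (1 - w)"
      using x by (simp add: w_def right_diff_distrib flip: norm_mult[of "of_real x", simplified norm_of_real])
        (simp add: w_def field_simps norm_divide)
    also have "\<dots> \<le> 1 * cmod (1 - w)"
      using x by (intro mult_right_mono) auto
    finally have "cmod (of_real x - y) / (1 - x) \<le> cmod (1 - w) / (1 - x)"
      using x by (simp add: divide_right_mono)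
    also have "\<dots> \<le> j * cmod (1 - w)"
      using mult_right_mono[OF j, of "cmod (1 - w)"] x by (simp add: field_simps)
    finally have "min 1 (cmod (of_real x - y) / (1 - x)) \<le> min 1 (j * cmod (1 - w))"
      by (rule min.mono[OF order_refl])
    then have "min 1 (cmod (of_real x - y) / (1 - x)) / 2 \<le> cmod (1 - w ^ m)"
      using order_trans[OF divide_right_mono m(2)] by simp
    then have "(\<kappa> * cmod u) * (\<kappa> * (min 1 (cmod (of_real x - y) / (1 - x)) / 2)) \<le>
        cmod A * (x ^ m * cmod (1 - w ^ m))"
      using uA \<open>\<kappa> \<le> x ^ m\<close> \<kappa> x by (intro mult_mono) auto
    also have "x ^ m * cmod (1 - w ^ m) = cmod (of_real x ^ m * (1 - w ^ m))"
      using x by (simp add: norm_mult norm_power)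
    also have "of_real x ^ m * (1 - w ^ m) = of_real x ^ m - y ^ m"
      using x by (simp add: w_def power_divide field_simps)
    also have "cmod A * cmod (of_real x ^ m - y ^ m) \<le> 2 * W"
      by (rule A)
    finally show ?thesis
      using \<kappa> by (simp add: field_simps power2_eq_square)
  qed
  show "cmod (u - v) \<le> (1 + 2 / \<kappa>') / \<kappa> * W" if \<kappa>': "0 < \<kappa>'" "\<kappa>' \<le> cmod y ^ j"
  proof -
    have "\<kappa>' * cmod v \<le> cmod B"
      using mult_right_mono[OF \<kappa>'(2), of "cmod v"] by (simp add: B_def norm_mult norm_power mult.commute)
    then have "(\<kappa>' * cmod v) * cmod (of_real x ^ j - y ^ j) \<le> 2 * W"
      using B[of j] by (meson mult_right_mono norm_ge_zero order_trans)
    then have v: "cmod v * cmod (of_real x ^ j - y ^ j) \<le> 2 * W / \<kappa>'"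
      using \<kappa>'(1) by (simp add: field_simps)
    have "cmod (u - v) * \<kappa> \<le> cmod (u - v) * x ^ j"
      using \<kappa> by (intro mult_left_mono) auto
    also have "\<dots> = cmod ((A - B) - v * (of_real x ^ j - y ^ j))"
    proof -
      have "cmod (u - v) * x ^ j = cmod ((u - v) * of_real x ^ j)"
        using x by (simp add: norm_mult norm_power)
      then show ?thesis by (simp add: A_def B_def algebra_simps)
    qed
    also have "\<dots> \<le> W + 2 * W / \<kappa>'"
      using norm_triangle_ineq4[of "A - B" "v * (of_real x ^ j - y ^ j)"] AB v by (simp add: norm_mult)
    finally show ?thesis
      using \<kappa>(1) by (simp add: field_simps)
  qed
qed

lemma exp_le_one_minus:
  fixes s :: real assumes "0 \<le> s" "s \<le> 1 / 2" shows "exp (- 2 * s) \<le> 1 - s"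
proof -
  have "1 \<le> (1 - s) * (1 + 2 * s)"
    using mult_left_mono[OF assms(2,1)] by (simp add: algebra_simps)
  also have "\<dots> \<le> (1 - s) * exp (2 * s)"
    using assms exp_ge_add_one_self[of "2 * s"] by (intro mult_left_mono) auto
  finally show ?thesis
    by (simp add: exp_minus field_simps)
qed

section \<open>Comparing the values at two points\<close>

text \<open>The geometric content of the constant \<open>C\<close>. Near the sphere the hypothesis puts \<open>\<langle>p,\<xi>\<rangle>\<close> within \<open>1/2\<close> of 1
  for the direction \<open>\<xi>\<close> of \<open>\<Phi>\<^sub>p(q)\<close>, so the component of \<open>\<Phi>\<^sub>p(q)\<close> along \<open>p\<close> is at least half of its
  norm. Up to a common factor, \<open>\<Phi>\<^sub>p(q)\<close> is \<open>p - q\<close> with the component orthogonal to \<open>p\<close> scaled by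
  \<open>s = (1 - |p|\<^sup>2)^(1/2)\<close>.\<close>
lemma Phi_direction_bound:
  fixes p q :: "complex ^ 'n"
  assumes p: "p \<noteq> 0" "norm p < 1" and C: "0 < C" "1 - (norm p)\<^sup>2 \<le> C / 2"
    and dir: "C < (1 - (norm p)\<^sup>2) / norm (1 - herm p (Phi p q /\<^sub>R norm (Phi p q)))"
  shows "(1 - (norm p)\<^sup>2) * (norm (q - p))\<^sup>2 \<le> 4 * (cmod (herm (q - p) p))\<^sup>2"
proof -
  define s where "s = sqrt (1 - (norm p)\<^sup>2)"
  have s: "0 < 1 - (norm p)\<^sup>2" "s\<^sup>2 = 1 - (norm p)\<^sup>2" "s\<^sup>2 \<le> 1"
    using weight_pos[OF p(2)] by (auto simp: s_def)
  define h where "h = herm p (Phi p q /\<^sub>R norm (Phi p q))"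
  have "cmod (1 - h) \<noteq> 0"
    using dir C(1) by (auto simp: h_def)
  then have "C * cmod (1 - h) < 1 - (norm p)\<^sup>2"
    using dir unfolding h_def[symmetric] by (simp add: pos_less_divide_eq)
  also have "\<dots> \<le> C * (1 / 2)"
    using C(2) by simp
  finally have "cmod (1 - h) < 1 / 2"
    using C(1) by (simp only: mult_less_cancel_left_pos)
  then have h: "1 / 2 \<le> cmod h"
    using norm_triangle_ineq2[of 1 h] by simp
  then have Phi0: "Phi p q \<noteq> 0"
    by (auto simp: h_def herm_def)
  have hPhi: "norm (Phi p q) \<le> 2 * cmod (herm p (Phi p q))"
    using h Phi0 by (simp add: h_def herm_linear_right norm_mult norm_divide field_simps)
  define \<Psi> where "\<Psi> = p - Pproj p q - s *\<^sub>R Qproj p q"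
  define c where "c = 1 / (1 - herm q p)"
  have Phi: "Phi p q = c *s \<Psi>"
    using p(1) by (simp add: Phi_def c_def \<Psi>_def s_def)
  have "c \<noteq> 0"
    using Phi0 Phi by auto
  then have h\<Psi>: "norm \<Psi> \<le> 2 * cmod (herm p \<Psi>)"
    using hPhi by (simp add: Phi norm_smult_vec herm_linear_right norm_mult)
  define f where "f = - Qproj p q"
  define \<mu> where "\<mu> = 1 - herm q p / herm p p"
  have pp: "herm p p \<noteq> 0"
    using p(1) by (simp add: herm_self)
  have e: "p - Pproj p q = \<mu> *s p"
    by (simp add: \<mu>_def Pproj_def vec_eq_iff algebra_simps)
  have fp: "herm f p = 0"
    using pp by (simp add: f_def Qproj_def Pproj_def herm_linear_left herm_def[of "- _"] sum_negf flip: herm_def)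
  then have pf: "herm p f = 0"
    using cnj_herm[of f p] by simp
  have \<Psi>: "\<Psi> = s *\<^sub>R f + \<mu> *s p"
    unfolding \<Psi>_def e[symmetric] by (simp add: f_def)
  have pq: "p - q = f + \<mu> *s p"
    unfolding e[symmetric] by (simp add: f_def Qproj_def)
  have "herm \<Psi> p = herm (p - q) p"
    unfolding \<Psi> pq by (simp add: herm_linear_left fp)
  moreover have "cmod (herm (p - q) p) = cmod (herm (q - p) p)"
    by (simp add: herm_linear_left norm_minus_commute)
  moreover have "cmod (herm p \<Psi>) = cmod (herm \<Psi> p)"
    by (simp flip: cnj_herm[of \<Psi> p])
  ultimately have "norm \<Psi> \<le> 2 * cmod (herm (q - p) p)"
    using h\<Psi> by simp
  then have \<Psi>2: "(norm \<Psi>)\<^sup>2 \<le> 4 * (cmod (herm (q - p) p))\<^sup>2"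
    using power_mono[of "norm \<Psi>" _ 2] by (fastforce simp: power_mult_distrib)
  have "(norm (p - q))\<^sup>2 = (norm f)\<^sup>2 + (cmod \<mu>)\<^sup>2 * (norm p)\<^sup>2"
    unfolding pq norm_power2_smult_add by (simp add: pf)
  moreover have "(norm \<Psi>)\<^sup>2 = s\<^sup>2 * (norm f)\<^sup>2 + (cmod \<mu>)\<^sup>2 * (norm p)\<^sup>2"
    unfolding \<Psi> norm_power2_smult_add by (simp add: pf herm_linear_right power_mult_distrib)
  moreover have "s\<^sup>2 * ((cmod \<mu>)\<^sup>2 * (norm p)\<^sup>2) \<le> 1 * ((cmod \<mu>)\<^sup>2 * (norm p)\<^sup>2)"
    using s by (intro mult_right_mono) auto
  ultimately have "s\<^sup>2 * (norm (p - q))\<^sup>2 \<le> (norm \<Psi>)\<^sup>2"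
    by (simp add: distrib_left)
  then show ?thesis
    using \<Psi>2 by (simp add: s(2) norm_minus_commute)
qed

text \<open>The hypotheses make \<open>q\<close> a point of an invariant ball of radius of order \<open>d\<close> around \<open>p\<close>, and on the
  complex line through \<open>p\<close> and \<open>q\<close> the disc around \<open>p\<close> that is \<open>1/(8d)\<close> times as large still has
  distance of order \<open>\<delta>\<close> from the sphere.\<close>
lemma near_point_estimate:
  fixes p q :: "complex ^ 'n"
  assumes g: "holo_ball g" "wnorm \<alpha> g \<le> ennreal G" "0 \<le> G" and \<alpha>: "0 \<le> \<alpha>"
    and \<delta>: "0 < \<delta>" "\<delta> \<le> 1 - (norm p)\<^sup>2" and d: "0 \<le> d" "d < 1 / 8"
    and pq: "cmod (herm (q - p) p) \<le> d * \<delta>" "\<delta> * (norm (q - p))\<^sup>2 \<le> 4 * (d * \<delta>)\<^sup>2"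
  shows "cmod (g q - g p) \<le> 16 * d * ((\<delta> / 2) powr - \<alpha> * G)"
    and "cmod (g q) \<le> (\<delta> / 2) powr - \<alpha> * G"
proof -
  have qp: "(norm (q - p))\<^sup>2 \<le> 4 * d\<^sup>2 * \<delta>"
    using pq(2) \<delta>(1) by (simp add: power2_eq_square)
  have disc: "norm (p + l *s (q - p)) < 1 \<and> cmod (g (p + l *s (q - p))) \<le> (\<delta> / 2) powr - \<alpha> * G"
    if l: "cmod l * d \<le> 1 / 8" for l
  proof -
    have "Re (l * herm (q - p) p) \<le> cmod l * cmod (herm (q - p) p)"
      using complex_Re_le_cmod[of "l * herm (q - p) p"] by (simp add: norm_mult)
    also have "\<dots> \<le> cmod l * (d * \<delta>)"
      using pq(1) by (intro mult_left_mono) auto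
    also have "\<dots> \<le> 1 / 8 * \<delta>"
      using mult_right_mono[OF l, of \<delta>] \<delta>(1) by (simp add: mult_ac)
    finally have 1: "Re (l * herm (q - p) p) \<le> \<delta> / 8" by simp
    have "(cmod l)\<^sup>2 * (norm (q - p))\<^sup>2 \<le> (cmod l)\<^sup>2 * (4 * d\<^sup>2 * \<delta>)"
      using qp by (intro mult_left_mono) auto
    also have "\<dots> = 4 * (cmod l * d)\<^sup>2 * \<delta>"
      by (simp add: power_mult_distrib)
    also have "\<dots> \<le> 4 * (1 / 8)\<^sup>2 * \<delta>"
      using l d \<delta> by (intro mult_right_mono mult_left_mono power_mono) auto
    finally have 2: "(cmod l)\<^sup>2 * (norm (q - p))\<^sup>2 \<le> \<delta> / 16"
      by (simp add: power2_eq_square)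
    have 3: "\<delta> / 2 \<le> 1 - (norm (p + l *s (q - p)))\<^sup>2"
      unfolding norm_power2_smult_add using 1 2 \<delta> by linarith
    then have "(norm (p + l *s (q - p)))\<^sup>2 < 1"
      using \<delta>(1) by linarith
    then show ?thesis
      using wnorm_le_pointwise[OF g(2,3) \<alpha> _ 3] \<delta>(1) by (simp add: abs_square_less_1 mult.commute)
  qed
  show "cmod (g q) \<le> (\<delta> / 2) powr - \<alpha> * G"
    using disc[of 1] d by simp
  show "cmod (g q - g p) \<le> 16 * d * ((\<delta> / 2) powr - \<alpha> * G)"
  proof (cases "d = 0")
    case True
    then show ?thesis
      using qp by simp
  next
    case False
    then have "cmod (g (p + (q - p)) - g p) \<le> 2 * ((\<delta> / 2) powr - \<alpha> * G) / (1 / (8 * d))"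
      using d by (intro slice_Schwarz(1)[OF g(1)] disc) (auto simp: field_simps)
    then show ?thesis
      by (simp add: mult_ac)
  qed
qed

text \<open>The factors \<open>exp (- 4)\<close> and \<open>exp (- 8)\<close> are lower bounds for \<open>x^j\<close> and for \<open>x^(2j)\<close> or
  \<open>|y|^j\<close> when \<open>j\<close> is about \<open>1/(1 - x)\<close>; the first summand comes from \<open>u (g p - g q)\<close>, the
  second from \<open>(u - v) g q\<close>, and the last factor from the norms of the powers and the
  growth of \<open>g\<close>.\<close>
definition test_const :: "real \<Rightarrow> real" where
  "test_const \<alpha> = (64 / exp (- 8) + (1 + 2 / exp (- 8)) / exp (- 4)) * (4 * \<alpha>) powr \<alpha>"

lemma test_const_pos: "0 < \<alpha> \<Longrightarrow> 0 < test_const \<alpha>"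
  unfolding test_const_def by (intro mult_pos_pos add_pos_pos divide_pos_pos) auto

text \<open>The decisive estimate at a point \<open>p\<close> near the sphere, with \<open>q\<close> anywhere in the ball. Let \<open>y\<close>
  be the component of \<open>q\<close> along \<open>p\<close>. If \<open>y\<close> is closer to \<open>|p|\<close> than \<open>\<delta>/8\<close>, the difference
  \<open>u g(p) - v g(q) = (u - v) g(q) - u (g(q) - g(p))\<close> is small; otherwise \<open>u\<close> itself
  is of order \<open>N \<delta>^\<alpha>\<close>, and already the single term \<open>u g(p)\<close> is small.\<close>
lemma one_sided_estimate:
  fixes p q :: "complex ^ 'n" and u v :: complex and J :: nat
  assumes \<alpha>: "0 < \<alpha>" and C: "0 < C" and N: "0 \<le> N" and J: "1 \<le> J"
    and p: "norm p < 1" "1 - norm p \<le> 1 / 4" "1 - norm p \<le> 1 / J" "1 - norm p \<le> C / 4"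
    and q: "norm q < 1"
    and dir: "p \<noteq> q \<Longrightarrow> C < (1 - (norm p)\<^sup>2) / norm (1 - herm p (Phi p q /\<^sub>R norm (Phi p q)))"
    and test: "\<And>i \<xi>. i \<ge> J \<Longrightarrow> norm \<xi> = 1 \<Longrightarrow>
      cmod (u * herm p \<xi> ^ i - v * herm q \<xi> ^ i) \<le> N * (2 * \<alpha> / i) powr \<alpha>"
    and g: "holo_ball g" "wnorm \<alpha> g \<le> ennreal G" "0 \<le> G"
  shows "cmod (u * g p - v * g q) \<le> test_const \<alpha> * N * G \<or> cmod (u * g p) \<le> test_const \<alpha> * N * G"
proof -
  define x where "x = norm p"
  define \<delta> where "\<delta> = 1 - x"
  have x: "0 < x" "x < 1" and \<delta>: "0 < \<delta>" "\<delta> \<le> 1 / 4"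
    using p by (auto simp: x_def \<delta>_def)
  define \<xi> where "\<xi> = (1 / x) *\<^sub>R p"
  have \<xi>: "norm \<xi> = 1"
    using x by (simp add: \<xi>_def x_def)
  have p\<xi>: "herm p \<xi> = of_real x"
    using x by (simp add: \<xi>_def herm_linear_right herm_self x_def power2_eq_square)
  define y where "y = herm q \<xi>"
  have y: "cmod y < 1"
    using norm_herm_le[of q \<xi>] q \<xi> by (simp add: y_def)
  define d where "d = cmod (of_real x - y) / \<delta>"
  have d: "0 \<le> d"
    using \<delta> by (simp add: d_def)
  have d\<delta>: "cmod (of_real x - y) = d * \<delta>"
    using \<delta> by (simp add: d_def)
  \<comment> \<open>The exponent at which \<open>x ^ j\<close> is bounded below while the norm of the test function is of order
    \<open>\<delta> powr \<alpha>\<close>.\<close>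
  define j where "j = nat \<lceil>1 / \<delta>\<rceil>"
  have j: "1 / \<delta> \<le> j" "j \<le> 1 / \<delta> + 1"
    using \<delta> by (auto simp: j_def of_nat_ceiling)
  have j\<delta>: "1 \<le> j * \<delta>" "j * \<delta> \<le> 2"
  proof -
    show "1 \<le> j * \<delta>"
      using j(1) \<delta>(1) by (simp add: pos_divide_le_eq)
    have "j * \<delta> \<le> (1 / \<delta> + 1) * \<delta>"
      using j(2) \<delta>(1) by (intro mult_right_mono) auto
    then show "j * \<delta> \<le> 2"
      using \<delta> by (simp add: distrib_right)
  qed
  have "real J \<le> 1 / \<delta>"
    using p(3) J \<delta>(1) by (simp add: \<delta>_def x_def field_simps)
  then have Jj: "J \<le> j"
    using j(1) by linarith
  have xj: "exp (- 4) \<le> x ^ j"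
  proof -
    have "exp (- 4) \<le> exp (- 2 * (j * \<delta>))"
      using j\<delta> by (simp add: mult.commute)
    also have "\<dots> = exp (- 2 * \<delta>) ^ j"
      by (simp add: mult_ac flip: exp_of_nat_mult)
    also have "\<dots> \<le> x ^ j"
      using exp_le_one_minus[of \<delta>] \<delta> by (intro power_mono) (auto simp: \<delta>_def)
    finally show ?thesis .
  qed
  define W where "W = N * (2 * \<alpha> * \<delta>) powr \<alpha>"
  have W: "0 \<le> W"
    using N by (simp add: W_def)
  have test': "cmod (u * of_real x ^ i - v * y ^ i) \<le> W" if "i \<ge> j" for i
  proof -
    have i: "1 \<le> i" "J \<le> i"
      using that Jj J by auto
    have "1 / i \<le> \<delta>"
    proof -
      have "1 \<le> i * \<delta>"
        by (rule order_trans[OF j\<delta>(1) mult_right_mono]) (use that \<delta>(1) in auto)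
      then show ?thesis
        using i(1) by (simp add: pos_divide_le_eq mult.commute)
    qed
    then have "2 * \<alpha> * (1 / i) \<le> 2 * \<alpha> * \<delta>"
      using \<alpha> by (intro mult_left_mono) auto
    then have "(2 * \<alpha> / i) powr \<alpha> \<le> (2 * \<alpha> * \<delta>) powr \<alpha>"
      using \<alpha> by (intro powr_mono2) auto
    then show ?thesis
      using test[OF i(2) \<xi>] N unfolding p\<xi> y_def[symmetric] W_def
      by (meson mult_left_mono order_trans)
  qed
  note coeff = coefficient_estimates[of x y "exp (- 4)" j u v W, OF x less_imp_le[OF y] _ xj _ test',
    folded \<delta>_def]
  have u_est: "cmod u * min 1 d \<le> 4 * W / exp (- 8)"
    using coeff(1) j\<delta> by (simp add: d_def flip: exp_of_nat_mult)
  define G' where "G' = (\<delta> / 2) powr - \<alpha> * G"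
  have G': "0 \<le> G'"
    using g(3) by (simp add: G'_def)
  have WG': "W * G' = (4 * \<alpha>) powr \<alpha> * N * G"
  proof -
    have "(2 * \<alpha> * \<delta>) powr \<alpha> = (4 * \<alpha>) powr \<alpha> * (\<delta> / 2) powr \<alpha>"
      using \<alpha> \<delta> by (simp add: mult.assoc flip: powr_mult)
    then show ?thesis
      using \<delta> by (simp add: W_def G'_def powr_minus field_simps)
  qed
  have \<delta>p: "\<delta> \<le> 1 - (norm p)\<^sup>2"
    using x by (simp add: \<delta>_def x_def power2_eq_square mult_left_le)
  show ?thesis
  proof (cases "d < 1 / 8")
    case False
    then have "cmod u * (1 / 8) \<le> cmod u * min 1 d"
      by (intro mult_left_mono) auto
    then have "cmod u \<le> 32 * W / exp (- 8)"
      using u_est by simp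
    moreover have "cmod (g p) \<le> G'"
      using wnorm_le_pointwise[OF g(2,3), of "\<delta> / 2" p] \<alpha> \<delta>p \<delta> by (simp add: G'_def mult.commute)
    ultimately have "cmod (u * g p) \<le> (32 * W / exp (- 8)) * G'"
      unfolding norm_mult using W by (intro mult_mono) auto
    also have "\<dots> = 32 / exp (- 8) * (W * G')"
      by simp
    also have "\<dots> \<le> (64 / exp (- 8) + (1 + 2 / exp (- 8)) / exp (- 4)) * (W * G')"
      using W G' by (intro mult_right_mono add_increasing2 divide_right_mono) auto
    finally show ?thesis
      unfolding WG' by (simp add: test_const_def mult_ac)
  next
    case True
    have hpq: "cmod (herm (q - p) p) \<le> d * \<delta>"
    proof -
      have "herm (q - p) p = of_real x * (y - of_real x)"
      proof -
        have "herm z p = of_real x * herm z \<xi>" for z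
          using x by (simp add: \<xi>_def herm_linear_right)
        then show ?thesis
          by (simp add: herm_linear_left p\<xi> y_def right_diff_distrib)
      qed
      then have "cmod (herm (q - p) p) = x * (d * \<delta>)"
        using x by (simp add: norm_mult norm_minus_commute flip: d\<delta>)
      also have "\<dots> \<le> 1 * (d * \<delta>)"
        using x d \<delta> by (intro mult_right_mono) auto
      finally show ?thesis by simp
    qed
    have npq: "\<delta> * (norm (q - p))\<^sup>2 \<le> 4 * (d * \<delta>)\<^sup>2"
    proof (cases "p = q")
      case False
      have "1 - (norm p)\<^sup>2 = \<delta> * (1 + x)"
        by (simp add: \<delta>_def x_def power2_eq_square algebra_simps)
      also have "\<dots> \<le> C / 4 * 2"
        using x p(4) \<delta> C by (intro mult_mono) (auto simp: \<delta>_def x_def)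
      finally have "1 - (norm p)\<^sup>2 \<le> C / 2" by simp
      then have "(1 - (norm p)\<^sup>2) * (norm (q - p))\<^sup>2 \<le> 4 * (cmod (herm (q - p) p))\<^sup>2"
        using x C p(1) by (intro Phi_direction_bound[OF _ _ _ _ dir[OF False]]) (auto simp: x_def)
      then show ?thesis
        using mult_right_mono[OF \<delta>p, of "(norm (q - p))\<^sup>2"] power_mono[OF hpq, of 2] by simp
    qed simp
    note near = near_point_estimate[OF g less_imp_le[OF \<alpha>] \<delta>(1) \<delta>p d True hpq npq, folded G'_def]
    have u_d: "cmod u * d \<le> 4 * W / exp (- 8)"
      using u_est True by simp
    have yj: "exp (- 8) \<le> cmod y ^ j"
    proof -
      have "x - cmod y \<le> d * \<delta>"
        using norm_triangle_ineq2[of "of_real x" y] x d\<delta> by simp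
      also have "\<dots> \<le> 1 * \<delta>"
        using True \<delta> by (intro mult_right_mono) auto
      finally have y2: "1 - 2 * \<delta> \<le> cmod y"
        by (simp add: \<delta>_def)
      have "exp (- 8) \<le> exp (- 4 * (j * \<delta>))"
        using j\<delta> by (simp add: mult.commute)
      also have "\<dots> = exp (- 2 * (2 * \<delta>)) ^ j"
        by (simp add: mult_ac flip: exp_of_nat_mult)
      also have "\<dots> \<le> cmod y ^ j"
        using exp_le_one_minus[of "2 * \<delta>"] \<delta> y2 by (intro power_mono) auto
      finally show ?thesis .
    qed
    have uv: "cmod (u - v) \<le> (1 + 2 / exp (- 8)) / exp (- 4) * W"
      using coeff(2)[OF _ _ _ _ yj] j\<delta> by simp
    have "u * g p - v * g q = (u - v) * g q - u * (g q - g p)"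
      by (simp add: algebra_simps)
    then have "cmod (u * g p - v * g q) \<le> cmod (u - v) * cmod (g q) + cmod u * cmod (g q - g p)"
      by (metis norm_mult norm_triangle_ineq4)
    also have "\<dots> \<le> (1 + 2 / exp (- 8)) / exp (- 4) * W * G' + cmod u * (16 * d * G')"
      using uv near W by (intro add_mono mult_mono mult_left_mono) auto
    also have "cmod u * (16 * d * G') = (cmod u * d) * (16 * G')"
      by simp
    also have "\<dots> \<le> (4 * W / exp (- 8)) * (16 * G')"
      using u_d G' by (intro mult_right_mono) auto
    finally have "cmod (u * g p - v * g q) \<le> (64 / exp (- 8) + (1 + 2 / exp (- 8)) / exp (- 4)) * (W * G')"
      by (simp add: algebra_simps)
    then show ?thesis
      unfolding WG' by (simp add: test_const_def mult_ac)
  qed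
qed

section \<open>The upper bound for the essential norm\<close>
lemma dilation_close:
  assumes \<alpha>: "0 \<le> \<alpha>" and \<rho>: "0 \<le> \<rho>" "\<rho> < 1" and e: "0 < e"
  obtains r where "0 < r" "r < 1"
    "\<And>f w. holo_ball f \<Longrightarrow> wnorm \<alpha> f \<le> 1 \<Longrightarrow> norm w \<le> \<rho> \<Longrightarrow> cmod (f w - f (r *\<^sub>R w)) \<le> e"
proof -
  define s where "s = (1 + \<rho>) / 2"
  have s: "\<rho> < s" "s < 1" "0 < s"
    using \<rho> by (auto simp: s_def)
  define B where "B = (1 - s\<^sup>2) powr - \<alpha>"
  have B: "0 \<le> B"
    by (simp add: B_def)
  define t where "t = min (1 / 2) (min ((s - \<rho>) / 2) (e * (s - \<rho>) / (2 * B + 1)))"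
  have "t \<le> (s - \<rho>) / 2"
    unfolding t_def by (intro min.coboundedI2 min.cobounded1)
  moreover have "t \<le> 1 / 2" "t \<le> e * (s - \<rho>) / (2 * B + 1)"
    unfolding t_def by (intro min.coboundedI2 min.cobounded2 min.cobounded1)+
  moreover have "0 < t"
    using s e B by (simp add: t_def)
  ultimately have t: "0 < t" "t \<le> 1 / 2" "t < s - \<rho>" "t \<le> e * (s - \<rho>) / (2 * B + 1)"
    using s by auto
  show thesis
  proof (rule that[of "1 - t"])
    show "0 < 1 - t" "1 - t < 1"
      using t by auto
    fix f :: "complex ^ 'a \<Rightarrow> complex" and w :: "complex ^ 'a"
    assume f: "holo_ball f" "wnorm \<alpha> f \<le> 1" and w: "norm w \<le> \<rho>"
    have bd: "cmod (f x) \<le> B" if "norm x < s" for x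
    proof -
      have "0 < 1 - s\<^sup>2" "1 - s\<^sup>2 \<le> 1 - (norm x)\<^sup>2"
        using s that by (auto simp: abs_square_less_1 power_mono)
      from wnorm_le_pointwise[OF _ _ \<alpha> this, of f 1] show ?thesis
        using f(2) by (simp add: B_def)
    qed
    have diff: "norm ((1 - t) *\<^sub>R w - w) \<le> t"
      using w \<rho> t mult_left_mono[of "norm w" 1 t] by (simp add: scaleR_diff_left)
    have "cmod (f ((1 - t) *\<^sub>R w) - f w) \<le> 2 * B * norm ((1 - t) *\<^sub>R w - w) / (s - \<rho>)"
      by (rule local_Lipschitz_estimate(1)[OF f(1) bd]) (use s w diff t in auto)
    also have "\<dots> \<le> (2 * B + 1) * t / (s - \<rho>)"
      using diff B s by (intro divide_right_mono mult_mono) auto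
    also have "\<dots> \<le> e"
      using t(4) s B by (simp add: field_simps)
    finally show "cmod (f w - f ((1 - t) *\<^sub>R w)) \<le> e"
      by (simp add: norm_minus_commute)
  qed
qed

lemma wnorm_herm_power_pos:
  assumes "norm \<xi> = 1" shows "0 < wnorm \<alpha> (\<lambda>z. herm z \<xi> ^ i)"
proof -
  have "wnorm \<alpha> (\<lambda>z. herm z \<xi> ^ i) \<noteq> 0"
    unfolding wnorm_eq_0_iff using assms
    by (auto intro!: bexI[of _ "(1 / 2) *\<^sub>R \<xi>"] simp: herm_linear_left herm_self)
  then show ?thesis
    by (simp add: zero_less_iff_neq_zero)
qed

lemma test_from_ratio:
  fixes u v :: "complex ^ 'n \<Rightarrow> complex"
  assumes "norm \<xi> = 1" "0 < \<alpha>" "1 \<le> i" "0 \<le> N" "norm z < 1"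
    and ratio: "wnorm \<beta> (\<lambda>z. u z * herm (\<phi> z) \<xi> ^ i - v z * herm (\<psi> z) \<xi> ^ i)
      / wnorm \<alpha> (\<lambda>z. herm z \<xi> ^ i) \<le> ennreal N"
  shows "(1 - (norm z)\<^sup>2) powr \<beta> * cmod (u z * herm (\<phi> z) \<xi> ^ i - v z * herm (\<psi> z) \<xi> ^ i)
    \<le> N * (2 * \<alpha> / i) powr \<alpha>"
proof -
  let ?b = "wnorm \<alpha> (\<lambda>z. herm z \<xi> ^ i)"
  let ?a = "wnorm \<beta> (\<lambda>z. u z * herm (\<phi> z) \<xi> ^ i - v z * herm (\<psi> z) \<xi> ^ i)"
  have b: "?b \<le> ennreal ((2 * \<alpha> / i) powr \<alpha>)"
    using assms by (intro wnorm_herm_power_le) auto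
  obtain b' where b': "?b = ennreal b'" "0 < b'"
    using wnorm_herm_power_pos[OF assms(1), of \<alpha> i] b by (cases ?b) (auto simp: top_unique)
  have "inverse (ennreal b') * ennreal b' = 1"
    using b'(2) by (simp add: inverse_ennreal flip: ennreal_mult)
  then have "?a = ?a / ?b * ?b"
    unfolding b'(1) divide_ennreal_def by (simp add: mult.assoc)
  also have "\<dots> \<le> ennreal N * ennreal ((2 * \<alpha> / i) powr \<alpha>)"
    using ratio b by (intro mult_mono) auto
  also have "\<dots> = ennreal (N * (2 * \<alpha> / i) powr \<alpha>)"
    using assms by (simp add: ennreal_mult)
  finally show ?thesis
    using assms by (intro wnorm_leD) auto
qed

text \<open>At a point where both arguments stay in a fixed compact part of the ball, \<open>f - f(r \<cdot>)\<close> is small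
  there and the multipliers are bounded. At any other point, the one-sided estimate is available from \<open>p\<close>
  or from \<open>q\<close>. Either it bounds the whole difference, or each of the two terms is small for its
  own reason. The dilation parameter \<open>r\<close> is chosen after the compact part, whose size depends
  on \<open>J\<close> and \<open>C\<close>; this is why these do not enter the constant.\<close>
proposition ess_norm_le_tail_bound:
  fixes u v :: "complex ^ 'n \<Rightarrow> complex" and \<phi> \<psi> :: "complex ^ 'n \<Rightarrow> complex ^ 'n" and J :: nat
  assumes \<alpha>: "0 < \<alpha>" and \<beta>: "0 \<le> \<beta>" and C: "0 < C" and N: "0 \<le> N" and J: "1 \<le> J"
    and self: "holo_self_map \<phi>" "holo_self_map \<psi>"
    and bd: "bounded_op \<alpha> \<beta> (wcomp u \<phi>)" "bounded_op \<alpha> \<beta> (wcomp v \<psi>)"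
    and dir\<phi>: "\<And>a. norm a < 1 \<Longrightarrow> \<phi> a \<noteq> \<psi> a \<Longrightarrow> C < (1 - (norm (\<phi> a))\<^sup>2) /
        norm (1 - herm (\<phi> a) (Phi (\<phi> a) (\<psi> a) /\<^sub>R norm (Phi (\<phi> a) (\<psi> a))))"
    and dir\<psi>: "\<And>a. norm a < 1 \<Longrightarrow> \<phi> a \<noteq> \<psi> a \<Longrightarrow> C < (1 - (norm (\<psi> a))\<^sup>2) /
        norm (1 - herm (\<psi> a) (Phi (\<psi> a) (\<phi> a) /\<^sub>R norm (Phi (\<psi> a) (\<phi> a))))"
    and tail: "\<And>i \<xi>. i \<ge> J \<Longrightarrow> norm \<xi> = 1 \<Longrightarrow>
      wnorm \<beta> (\<lambda>z. u z * herm (\<phi> z) \<xi> ^ i - v z * herm (\<psi> z) \<xi> ^ i)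
        / wnorm \<alpha> (\<lambda>z. herm z \<xi> ^ i) \<le> ennreal N"
  shows "ess_norm \<alpha> \<beta> (\<lambda>f z. wcomp u \<phi> f z - wcomp v \<psi> f z) \<le> ennreal (4 * test_const \<alpha> * N)"
proof (rule ennreal_le_epsilon)
  fix e :: real assume e: "0 < e"
  have self': "norm (\<phi> z) < 1" "norm (\<psi> z) < 1" if "norm z < 1" for z
    using self that by (simp_all add: holo_self_map_norm)
  have \<alpha>0: "0 \<le> \<alpha>"
    using \<alpha> by simp
  obtain U where U: "0 \<le> U" "wnorm \<beta> u \<le> ennreal U"
    using bounded_wcomp_multiplier[OF bd(1) self(1) \<alpha>0] .
  obtain V where V: "0 \<le> V" "wnorm \<beta> v \<le> ennreal V"
    using bounded_wcomp_multiplier[OF bd(2) self(2) \<alpha>0] .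
  define \<epsilon> where "\<epsilon> = e / (U + V + 1)"
  have UV: "0 < U + V + 1"
    using U V by simp
  have \<epsilon>: "0 < \<epsilon>" "(U + V) * \<epsilon> \<le> e"
    using e UV by (auto simp: \<epsilon>_def pos_divide_le_eq)
  define \<delta> where "\<delta> = min (1 / 4) (min (1 / J) (C / 4))"
  have \<delta>: "0 < \<delta>" "\<delta> \<le> 1 / 4" "\<delta> \<le> 1 / J" "\<delta> \<le> C / 4"
    using C J by (auto simp: \<delta>_def)
  obtain r where r: "0 < r" "r < 1" and close: "\<And>(f :: complex ^ 'n \<Rightarrow> complex) w. holo_ball f \<Longrightarrow> wnorm \<alpha> f \<le> 1 \<Longrightarrow>
      norm w \<le> 1 - \<delta> \<Longrightarrow> cmod (f w - f (r *\<^sub>R w)) \<le> \<epsilon>"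
  proof (rule dilation_close[of \<alpha> "1 - \<delta>" \<epsilon>])
    show "0 \<le> \<alpha>" "0 \<le> 1 - \<delta>" "1 - \<delta> < 1" "0 < \<epsilon>"
      using \<alpha>0 \<delta> \<epsilon> by auto
  qed (rule that)
  let ?T = "\<lambda>f z. wcomp u \<phi> f z - wcomp v \<psi> f z"
  let ?K = "\<lambda>f z. wcomp u \<phi> (dilation r f) z - wcomp v \<psi> (dilation r f) z"
  define A where "A = test_const \<alpha> * N * 2"
  have A: "0 \<le> A"
    using test_const_pos[OF \<alpha>] N by (simp add: A_def)
  have "compact_op \<alpha> \<beta> ?K"
    by (rule compact_op_wcomp_dilation[OF bd self \<alpha>0 \<beta> r])
  then have "ess_norm \<alpha> \<beta> ?T \<le> op_norm \<alpha> \<beta> (\<lambda>f z. ?T f z - ?K f z)"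
    unfolding ess_norm_def by (intro INF_lower2[of ?K]) auto
  also have "\<dots> \<le> ennreal (2 * A + e)"
    unfolding op_norm_def
  proof (rule SUP_least)
    fix f :: "complex ^ 'n \<Rightarrow> complex" assume "f \<in> {f \<in> Hinf \<alpha>. wnorm \<alpha> f \<le> 1}"
    then have f: "f \<in> Hinf \<alpha>" "wnorm \<alpha> f \<le> 1" by auto
    define g where "g = (\<lambda>w. f w - dilation r f w)"
    have g: "holo_ball g"
      unfolding g_def by (intro holo_ball_diff HinfD(1)[OF f(1)] HinfD(1)[OF dilation_Hinf[OF r \<alpha>0 f(1)]])
    have "wnorm \<alpha> (dilation r f) \<le> 1"
      using wnorm_dilation_le[OF r \<alpha>0] f(2) by (rule order_trans)
    then have "wnorm \<alpha> g \<le> 1 + 1"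
      unfolding g_def using f(2) by (intro order_trans[OF wnorm_diff] add_mono) auto
    then have g2: "wnorm \<alpha> g \<le> ennreal 2"
      by simp
    have gsmall: "cmod (g w) \<le> \<epsilon>" if "norm w \<le> 1 - \<delta>" for w
      using close[OF HinfD(1)[OF f(1)] f(2) that] that \<delta> by (simp add: g_def dilation_def)
    show "wnorm \<beta> (\<lambda>z. ?T f z - ?K f z) \<le> ennreal (2 * A + e)"
    proof (rule wnorm_leI)
      fix z :: "complex ^ 'n" assume z: "norm z < 1"
      define \<omega> where "\<omega> = (1 - (norm z)\<^sup>2) powr \<beta>"
      have \<omega>: "0 \<le> \<omega>"
        by (simp add: \<omega>_def)
      define a where "a = of_real \<omega> * u z"
      define b where "b = of_real \<omega> * v z"
      have ab: "cmod a \<le> U" "cmod b \<le> V"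
        using wnorm_leD[OF U(2,1) z] wnorm_leD[OF V(2,1) z] \<omega>
        by (auto simp: a_def b_def norm_mult simp flip: \<omega>_def)
      have test: "cmod (a * herm (\<phi> z) \<xi> ^ i - b * herm (\<psi> z) \<xi> ^ i) \<le> N * (2 * \<alpha> / i) powr \<alpha>"
        if "i \<ge> J" "norm \<xi> = 1" for i \<xi>
      proof -
        have "a * herm (\<phi> z) \<xi> ^ i - b * herm (\<psi> z) \<xi> ^ i =
            of_real \<omega> * (u z * herm (\<phi> z) \<xi> ^ i - v z * herm (\<psi> z) \<xi> ^ i)"
          by (simp add: a_def b_def algebra_simps)
        then show ?thesis
          using test_from_ratio[OF that(2) \<alpha> _ N z tail[OF that]] J that(1) \<omega>
          by (simp add: norm_mult flip: \<omega>_def)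
      qed
      let ?p = "\<phi> z" and ?q = "\<psi> z"
      have one: "cmod (a * g ?p - b * g ?q) \<le> A \<or> cmod (a * g ?p) \<le> A + U * \<epsilon>"
      proof (cases "norm ?p \<le> 1 - \<delta>")
        case True
        then have "cmod (a * g ?p) \<le> U * \<epsilon>"
          unfolding norm_mult using ab gsmall U by (intro mult_mono) auto
        then show ?thesis
          using A by simp
      next
        case False
        have "cmod (a * g ?p - b * g ?q) \<le> A \<or> cmod (a * g ?p) \<le> A"
          unfolding A_def
          using one_sided_estimate[OF \<alpha> C N J self'(1)[OF z] _ _ _ self'(2)[OF z] dir\<phi>[OF z] test g g2]
            False \<delta> by fastforce
        then show ?thesis
          using U \<epsilon> by (auto intro: add_increasing2)
      qed
      have two: "cmod (b * g ?q - a * g ?p) \<le> A \<or> cmod (b * g ?q) \<le> A + V * \<epsilon>"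
      proof (cases "norm ?q \<le> 1 - \<delta>")
        case True
        then have "cmod (b * g ?q) \<le> V * \<epsilon>"
          unfolding norm_mult using ab gsmall V by (intro mult_mono) auto
        then show ?thesis
          using A by simp
      next
        case False
        have test': "cmod (b * herm (\<psi> z) \<xi> ^ i - a * herm (\<phi> z) \<xi> ^ i) \<le> N * (2 * \<alpha> / i) powr \<alpha>"
          if "i \<ge> J" "norm \<xi> = 1" for i \<xi>
          using test[OF that] by (simp add: norm_minus_commute)
        have "cmod (b * g ?q - a * g ?p) \<le> A \<or> cmod (b * g ?q) \<le> A"
          unfolding A_def
          using one_sided_estimate[OF \<alpha> C N J self'(2)[OF z] _ _ _ self'(1)[OF z] dir\<psi>[OF z not_sym] test' g g2]
            False \<delta> by fastforce
        then show ?thesis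
          using V \<epsilon> by (auto intro: add_increasing2)
      qed
      have "cmod (a * g ?p - b * g ?q) \<le> 2 * A + (U + V) * \<epsilon>"
      proof -
        have "0 \<le> U * \<epsilon>" "0 \<le> V * \<epsilon>"
          using U V \<epsilon> by auto
        moreover have "cmod (a * g ?p - b * g ?q) \<le> cmod (a * g ?p) + cmod (b * g ?q)"
          by (rule norm_triangle_ineq4)
        ultimately show ?thesis
          using one two A unfolding norm_minus_commute[of "b * g ?q"] distrib_right
          by (elim disjE) linarith+
      qed
      moreover have "?T f z - ?K f z = u z * g ?p - v z * g ?q"
        using z self'[OF z] by (simp add: wcomp_def g_def algebra_simps)
      then have "\<omega> * cmod (?T f z - ?K f z) = cmod (a * g ?p - b * g ?q)"
        using \<omega> by (simp add: a_def b_def norm_mult mult.assoc flip: right_diff_distrib)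
      ultimately show "(1 - (norm z)\<^sup>2) powr \<beta> * cmod (?T f z - ?K f z) \<le> 2 * A + e"
        using \<epsilon>(2) unfolding \<omega>_def by linarith
    qed
  qed
  also have "\<dots> = ennreal (4 * test_const \<alpha> * N) + ennreal e"
    using A e by (simp add: A_def mult_ac flip: ennreal_plus)
  finally show "ess_norm \<alpha> \<beta> ?T \<le> ennreal (4 * test_const \<alpha> * N) + ennreal e" .
qed

section \<open>The equivalence\<close>
lemma le_mult_limsup:
  fixes X :: "nat \<Rightarrow> ennreal" and E :: ennreal and c :: real
  assumes c: "0 < c"
    and tail: "\<And>N J. 0 \<le> N \<Longrightarrow> 1 \<le> J \<Longrightarrow> (\<And>i. i \<ge> J \<Longrightarrow> X i \<le> ennreal N) \<Longrightarrow> E \<le> ennreal (c * N)"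
  shows "E \<le> ennreal c * limsup X"
proof (cases "limsup X")
  case top
  then show ?thesis
    using c by (simp add: ennreal_mult_top)
next
  case (real l)
  show ?thesis
  proof (rule ennreal_le_epsilon)
    fix e :: real assume e: "0 < e"
    have "limsup X < ennreal (l + e / c)"
      using real e c by (simp add: ennreal_less_iff)
    then have "\<forall>\<^sub>F i in sequentially. X i < ennreal (l + e / c)"
      by (rule Limsup_lessD)
    then obtain J where J: "\<And>i. i \<ge> J \<Longrightarrow> X i < ennreal (l + e / c)"
      by (auto simp: eventually_sequentially)
    have "E \<le> ennreal (c * (l + e / c))"
      using real e c less_imp_le[OF J] by (intro tail[of _ "max 1 J"]) auto
    also have "\<dots> = ennreal c * limsup X + ennreal e"
      using real e c by (simp add: distrib_left ennreal_mult)
    finally show "E \<le> ennreal c * limsup X + ennreal e" .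
  qed
qed

text \<open>The norm of \<open>\<langle>z,\<xi>\<rangle>^j \<langle>z,\<xi>'\<rangle>\<close> is tested at a point that is close to \<open>\<xi>\<close> but is pushed by \<open>\<epsilon>\<close> in the
  direction of \<open>\<xi>'\<close>, with a phase that keeps the two contributions to \<open>\<langle>z,\<xi>'\<rangle>\<close> from cancelling; this
  works even for orthogonal \<open>\<xi>\<close> and \<open>\<xi>'\<close>.\<close>
lemma herm_product_lower_bound:
  fixes \<xi> \<xi>' :: "complex ^ 'n"
  assumes s: "0 < s" "s < 1" and \<xi>: "norm \<xi> = 1" "norm \<xi>' = 1"
  defines "\<epsilon> \<equiv> (1 - s) / 4"
  defines "t \<equiv> 1 / (1 + 2 * \<epsilon>)"
  shows "\<exists>z. norm z \<le> t * (1 + \<epsilon>) \<and> s \<le> cmod (herm z \<xi>) \<and> t * \<epsilon> \<le> cmod (herm z \<xi>')"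
proof -
  have \<epsilon>: "0 < \<epsilon>" "s = 1 - 4 * \<epsilon>"
    using s by (simp_all add: \<epsilon>_def field_simps)
  then have t: "0 < t"
    by (simp add: t_def)
  define h where "h = herm \<xi> \<xi>'"
  define l where "l = (if h = 0 then 1 else sgn h)"
  have l: "cmod l = 1" "cmod (h + of_real \<epsilon> * l) = cmod h + \<epsilon>"
  proof -
    show "cmod l = 1"
      by (simp add: l_def norm_sgn)
    have "h + of_real \<epsilon> * l = of_real (cmod h + \<epsilon>) * l"
      by (simp add: l_def sgn_div_norm scaleR_conv_of_real field_simps)
    then have "cmod (h + of_real \<epsilon> * l) = \<bar>cmod h + \<epsilon>\<bar> * cmod l"
      by (simp only: norm_mult norm_of_real)
    then show "cmod (h + of_real \<epsilon> * l) = cmod h + \<epsilon>"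
      using \<epsilon>(1) \<open>cmod l = 1\<close> by simp
  qed
  define w where "w = \<xi> + (of_real \<epsilon> * l) *s \<xi>'"
  have "norm w \<le> 1 + \<epsilon>"
    using norm_triangle_ineq[of \<xi> "(of_real \<epsilon> * l) *s \<xi>'"] \<xi> l(1) \<epsilon>(1)
    by (simp add: w_def norm_smult_vec norm_mult)
  then have n: "norm (t *\<^sub>R w) \<le> t * (1 + \<epsilon>)"
    using t by simp
  have "herm w \<xi> = 1 + of_real \<epsilon> * l * herm \<xi>' \<xi>"
    using \<xi> by (simp add: w_def herm_linear_left herm_self)
  moreover have "cmod (of_real \<epsilon> * l * herm \<xi>' \<xi>) \<le> \<epsilon>"
    using norm_herm_le[of \<xi>' \<xi>] \<xi> l(1) \<epsilon>(1) by (simp add: norm_mult mult_left_le)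
  ultimately have "1 - \<epsilon> \<le> cmod (herm w \<xi>)"
    using norm_diff_ineq[of 1 "of_real \<epsilon> * l * herm \<xi>' \<xi>"] by simp
  then have "t * (1 - \<epsilon>) \<le> cmod (herm (t *\<^sub>R w) \<xi>)"
    using t by (simp add: herm_linear_left norm_mult)
  moreover have "s \<le> t * (1 - \<epsilon>)"
  proof -
    have "s * (1 + 2 * \<epsilon>) \<le> 1 - \<epsilon>"
      unfolding \<epsilon>(2) using \<epsilon>(1) zero_le_square[of \<epsilon>] by (simp add: algebra_simps)
    then show ?thesis
      using \<epsilon>(1) by (simp add: t_def field_simps)
  qed
  moreover have "t * \<epsilon> \<le> cmod (herm (t *\<^sub>R w) \<xi>')"
  proof -
    have "herm w \<xi>' = h + of_real \<epsilon> * l"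
      using \<xi> by (simp add: w_def herm_linear_left herm_self h_def)
    then show ?thesis
      using t l(2) by (simp add: herm_linear_left norm_mult)
  qed
  ultimately show ?thesis
    using n by (intro exI[of _ "t *\<^sub>R w"]) auto
qed

lemma wnorm_herm_product_lower:
  fixes s :: real
  assumes s: "0 < s" "s < 1" and \<alpha>: "0 \<le> \<alpha>"
  shows "\<exists>c>0. \<forall>j. \<forall>\<xi> \<xi>' :: complex ^ 'n. norm \<xi> = 1 \<longrightarrow> norm \<xi>' = 1 \<longrightarrow>
    ennreal (c * s ^ j) \<le> wnorm \<alpha> (\<lambda>z. herm z \<xi> ^ j * herm z \<xi>')"
proof -
  define \<epsilon> where "\<epsilon> = (1 - s) / 4"
  define t where "t = 1 / (1 + 2 * \<epsilon>)"
  define b where "b = t * (1 + \<epsilon>)"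
  have "0 < \<epsilon>"
    using s by (simp add: \<epsilon>_def)
  then have \<epsilon>: "0 < \<epsilon>" "0 < t" "0 < b" "b < 1"
    by (simp_all add: t_def b_def)
  define c where "c = (1 - b\<^sup>2) powr \<alpha> * (t * \<epsilon>)"
  have b2: "0 < 1 - b\<^sup>2"
    using \<epsilon> by (simp add: abs_square_less_1)
  have "ennreal (c * s ^ j) \<le> wnorm \<alpha> (\<lambda>z. herm z \<xi> ^ j * herm z \<xi>')"
    if \<xi>: "norm \<xi> = 1" "norm \<xi>' = 1" for j and \<xi> \<xi>' :: "complex ^ 'n"
  proof -
    obtain z where z: "norm z \<le> b" "s \<le> cmod (herm z \<xi>)" "t * \<epsilon> \<le> cmod (herm z \<xi>')"
      using herm_product_lower_bound[OF s \<xi>] unfolding b_def t_def \<epsilon>_def by blast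
    have "(1 - b\<^sup>2) powr \<alpha> \<le> (1 - (norm z)\<^sup>2) powr \<alpha>"
      using z(1) \<alpha> b2 by (intro powr_mono2) (auto simp: power_mono)
    moreover have "s ^ j * (t * \<epsilon>) \<le> cmod (herm z \<xi> ^ j * herm z \<xi>')"
      unfolding norm_mult norm_power using z s \<epsilon> by (intro mult_mono power_mono) auto
    ultimately have "(1 - b\<^sup>2) powr \<alpha> * (s ^ j * (t * \<epsilon>)) \<le>
        (1 - (norm z)\<^sup>2) powr \<alpha> * cmod (herm z \<xi> ^ j * herm z \<xi>')"
      using s \<epsilon> by (intro mult_mono) auto
    then have "ennreal (c * s ^ j) \<le> ennreal ((1 - (norm z)\<^sup>2) powr \<alpha> * cmod (herm z \<xi> ^ j * herm z \<xi>'))"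
      by (intro ennreal_leI) (simp add: c_def mult_ac)
    also have "\<dots> \<le> wnorm \<alpha> (\<lambda>z. herm z \<xi> ^ j * herm z \<xi>')"
      using z(1) \<epsilon> by (intro wnorm_upper) auto
    finally show ?thesis .
  qed
  moreover have "0 < c"
    using b2 \<epsilon> by (simp add: c_def)
  ultimately show ?thesis by blast
qed

theorem theorem3p2:
  fixes \<alpha> \<beta> C :: real
  assumes "0 < \<alpha>" and "0 < \<beta>" and "0 < C"
  shows "\<exists>c1>0. \<exists>c2>0.
    \<forall>(u :: complex ^ 'n \<Rightarrow> complex) (v :: complex ^ 'n \<Rightarrow> complex)
      (\<phi> :: complex ^ 'n \<Rightarrow> complex ^ 'n) (\<psi> :: complex ^ 'n \<Rightarrow> complex ^ 'n).
      holo_ball u \<longrightarrow> holo_ball v \<longrightarrow> holo_self_map \<phi> \<longrightarrow> holo_self_map \<psi> \<longrightarrow>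
      ennreal C < (INF a\<in>{a \<in> unit_ball. \<phi> a \<noteq> \<psi> a}.
        ennreal ((1 - (norm (\<phi> a))\<^sup>2) /
          norm (1 - herm (\<phi> a) (Phi (\<phi> a) (\<psi> a) /\<^sub>R norm (Phi (\<phi> a) (\<psi> a)))))) \<longrightarrow>
      ennreal C < (INF a\<in>{a \<in> unit_ball. \<phi> a \<noteq> \<psi> a}.
        ennreal ((1 - (norm (\<psi> a))\<^sup>2) /
          norm (1 - herm (\<psi> a) (Phi (\<psi> a) (\<phi> a) /\<^sub>R norm (Phi (\<psi> a) (\<phi> a)))))) \<longrightarrow>
      bounded_op \<alpha> \<beta> (wcomp u \<phi>) \<longrightarrow> bounded_op \<alpha> \<beta> (wcomp v \<psi>) \<longrightarrow>
      (let
         E = ess_norm \<alpha> \<beta> (\<lambda>f z. wcomp u \<phi> f z - wcomp v \<psi> f z);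
         L = limsup (\<lambda>j. SUP \<xi>\<in>sphere 0 1.
               wnorm \<beta> (\<lambda>z. u z * herm (\<phi> z) \<xi> ^ j - v z * herm (\<psi> z) \<xi> ^ j)
               / wnorm \<alpha> (\<lambda>z. herm z \<xi> ^ j));
         M = limsup (\<lambda>j. SUP (\<xi>, \<xi>')\<in>sphere 0 1 \<times> sphere 0 1.
               wnorm \<beta> (\<lambda>z. u z * herm (\<phi> z) \<xi> ^ j * herm (\<phi> z) \<xi>'
                          - v z * herm (\<psi> z) \<xi> ^ j * herm (\<psi> z) \<xi>')
               / wnorm \<alpha> (\<lambda>z. herm z \<xi> ^ j * herm z \<xi>'))
       in E \<le> ennreal c1 * (L + M) \<and> L + M \<le> ennreal c2 * E)"
proof -
  define c1 where "c1 = 4 * test_const \<alpha>"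
  have c1: "0 < c1"
    using test_const_pos[OF assms(1)] by (simp add: c1_def)
  have "ess_norm \<alpha> \<beta> (\<lambda>f z. wcomp u \<phi> f z - wcomp v \<psi> f z) \<le> ennreal c1 * (L + M) \<and>
      L + M \<le> ennreal 2 * ess_norm \<alpha> \<beta> (\<lambda>f z. wcomp u \<phi> f z - wcomp v \<psi> f z)"
    if self: "holo_self_map \<phi>" "holo_self_map \<psi>"
      and dir\<phi>: "ennreal C < (INF a\<in>{a \<in> unit_ball. \<phi> a \<noteq> \<psi> a}.
        ennreal ((1 - (norm (\<phi> a))\<^sup>2) /
          norm (1 - herm (\<phi> a) (Phi (\<phi> a) (\<psi> a) /\<^sub>R norm (Phi (\<phi> a) (\<psi> a))))))"
      and dir\<psi>: "ennreal C < (INF a\<in>{a \<in> unit_ball. \<phi> a \<noteq> \<psi> a}.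
        ennreal ((1 - (norm (\<psi> a))\<^sup>2) /
          norm (1 - herm (\<psi> a) (Phi (\<psi> a) (\<phi> a) /\<^sub>R norm (Phi (\<psi> a) (\<phi> a))))))"
      and bd: "bounded_op \<alpha> \<beta> (wcomp u \<phi>)" "bounded_op \<alpha> \<beta> (wcomp v \<psi>)"
      and L: "L = limsup (\<lambda>j. SUP \<xi>\<in>sphere 0 1.
               wnorm \<beta> (\<lambda>z. u z * herm (\<phi> z) \<xi> ^ j - v z * herm (\<psi> z) \<xi> ^ j)
               / wnorm \<alpha> (\<lambda>z. herm z \<xi> ^ j))"
      and M: "M = limsup (\<lambda>j. SUP (\<xi>, \<xi>')\<in>sphere 0 1 \<times> sphere 0 1.
               wnorm \<beta> (\<lambda>z. u z * herm (\<phi> z) \<xi> ^ j * herm (\<phi> z) \<xi>'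
                          - v z * herm (\<psi> z) \<xi> ^ j * herm (\<psi> z) \<xi>')
               / wnorm \<alpha> (\<lambda>z. herm z \<xi> ^ j * herm z \<xi>'))"
    for u v :: "complex ^ 'n \<Rightarrow> complex" and \<phi> \<psi> :: "complex ^ 'n \<Rightarrow> complex ^ 'n" and L M
  proof -
    let ?E = "ess_norm \<alpha> \<beta> (\<lambda>f z. wcomp u \<phi> f z - wcomp v \<psi> f z)"
    have pt: "C < r" if "ennreal C < (INF a\<in>A. ennreal (R a))" "a \<in> A" "R a = r"
      for A :: "(complex ^ 'n) set" and a R r
      using less_le_trans[OF that(1) INF_lower[OF that(2)]] that(3) \<open>0 < C\<close>
      by (simp add: ennreal_less_iff)
    have "?E \<le> ennreal c1 * L"
      unfolding L
    proof (rule le_mult_limsup[OF c1])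
      fix N :: real and J :: nat
      assume N: "0 \<le> N" and J: "1 \<le> J" and tail: "\<And>i. i \<ge> J \<Longrightarrow>
        (SUP \<xi>\<in>sphere 0 1. wnorm \<beta> (\<lambda>z. u z * herm (\<phi> z) \<xi> ^ i - v z * herm (\<psi> z) \<xi> ^ i)
          / wnorm \<alpha> (\<lambda>z. herm z \<xi> ^ i)) \<le> ennreal N"
      show "?E \<le> ennreal (c1 * N)"
        unfolding c1_def
      proof (rule ess_norm_le_tail_bound[OF assms(1) less_imp_le[OF assms(2)] assms(3) N J self bd])
        show "C < (1 - (norm (\<phi> a))\<^sup>2) /
            norm (1 - herm (\<phi> a) (Phi (\<phi> a) (\<psi> a) /\<^sub>R norm (Phi (\<phi> a) (\<psi> a))))"
          if "norm a < 1" "\<phi> a \<noteq> \<psi> a" for a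
          by (rule pt[OF dir\<phi>]) (use that in auto)
        show "C < (1 - (norm (\<psi> a))\<^sup>2) /
            norm (1 - herm (\<psi> a) (Phi (\<psi> a) (\<phi> a) /\<^sub>R norm (Phi (\<psi> a) (\<phi> a))))"
          if "norm a < 1" "\<phi> a \<noteq> \<psi> a" for a
          by (rule pt[OF dir\<psi>]) (use that in auto)
        show "wnorm \<beta> (\<lambda>z. u z * herm (\<phi> z) \<xi> ^ i - v z * herm (\<psi> z) \<xi> ^ i)
            / wnorm \<alpha> (\<lambda>z. herm z \<xi> ^ i) \<le> ennreal N"
          if "i \<ge> J" "norm \<xi> = 1" for i \<xi>
          by (rule order_trans[OF SUP_upper tail[OF that(1)]]) (use that in auto)
      qed
    qed
    also have "\<dots> \<le> ennreal c1 * (L + M)"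
      by (intro mult_left_mono) auto
    finally have upper: "?E \<le> ennreal c1 * (L + M)" .
    have "L \<le> ?E"
      unfolding L
    proof (rule limsup_test_functions_le_ess_norm[OF assms(1) self, where G = "\<lambda>j \<xi> z. herm z \<xi> ^ j"])
      show "holo_ball (\<lambda>z. herm z \<xi> ^ j)" for j and \<xi> :: "complex ^ 'n"
        by (intro holo_ball_power holo_ball_herm)
      show "cmod (herm z \<xi> ^ j) \<le> norm z ^ j" if "\<xi> \<in> sphere 0 1" for j and \<xi> z :: "complex ^ 'n"
        using norm_herm_le[of z \<xi>] that by (simp add: norm_power power_mono)
      show "\<exists>c>0. \<forall>j. \<forall>\<xi>\<in>sphere 0 1. ennreal (c * s ^ j) \<le> wnorm \<alpha> (\<lambda>z :: complex ^ 'n. herm z \<xi> ^ j)"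
        if s: "0 < s" "s < 1" for s
      proof -
        have "ennreal ((1 - s\<^sup>2) powr \<alpha> * s ^ j) \<le> wnorm \<alpha> (\<lambda>z. herm z \<xi> ^ j)"
          if "norm \<xi> = 1" for j and \<xi> :: "complex ^ 'n"
          using wnorm_upper[of "s *\<^sub>R \<xi>" \<alpha> "\<lambda>z. herm z \<xi> ^ j"] that s
          by (simp add: herm_linear_left herm_self norm_power)
        moreover have "0 < (1 - s\<^sup>2) powr \<alpha>"
          using weight_pos[of s] s by simp
        ultimately show ?thesis
          by (intro exI[of _ "(1 - s\<^sup>2) powr \<alpha>"]) auto
      qed
    qed
    moreover have "M \<le> ?E"
    proof -
      define G where "G = (\<lambda>j (\<xi>, \<xi>') (z :: complex ^ 'n). herm z \<xi> ^ j * herm z \<xi>')"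
      have "M = limsup (\<lambda>j. SUP p\<in>sphere 0 1 \<times> sphere 0 1.
          wnorm \<beta> (\<lambda>z. u z * G j p (\<phi> z) - v z * G j p (\<psi> z)) / wnorm \<alpha> (G j p))"
        unfolding M G_def by (intro arg_cong[where f = limsup] ext SUP_cong) (auto simp: mult.assoc)
      also have "\<dots> \<le> ?E"
      proof (rule limsup_test_functions_le_ess_norm[OF assms(1) self])
        show "holo_ball (G j p)" for j p
          unfolding G_def by (cases p) (auto intro!: holo_ball_mult holo_ball_power holo_ball_herm)
        show "cmod (G j p z) \<le> norm z ^ j" if p01: "p \<in> sphere 0 1 \<times> sphere 0 1" and z: "norm z < 1" for j p z
        proof -
          obtain \<xi> \<xi>' where p: "p = (\<xi>, \<xi>')" "norm \<xi> = 1" "norm \<xi>' = 1"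
            using p01 by auto
          have "cmod (herm z \<xi>) \<le> norm z" "cmod (herm z \<xi>') \<le> norm z"
            using norm_herm_le[of z \<xi>] norm_herm_le[of z \<xi>'] p by auto
          then have "cmod (herm z \<xi> ^ j * herm z \<xi>') \<le> norm z ^ j * 1"
            unfolding norm_mult norm_power using z by (intro mult_mono power_mono) auto
          then show ?thesis by (simp add: G_def p)
        qed
        show "\<exists>c>0. \<forall>j. \<forall>p\<in>sphere 0 1 \<times> sphere 0 1. ennreal (c * s ^ j) \<le> wnorm \<alpha> (G j p)"
          if "0 < s" "s < 1" for s
          using wnorm_herm_product_lower[OF that less_imp_le[OF assms(1)], where 'n = 'n]
          by (fastforce simp: G_def)
      qed
      finally show ?thesis .
    qed
    ultimately have "L + M \<le> ?E + ?E"
      by (rule add_mono)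
    then show ?thesis
      using upper by (simp add: mult_2)
  qed
  then show ?thesis
    unfolding Let_def using c1 by (intro exI[of _ c1] conjI exI[of _ "2::real"] allI impI) auto
qed

end
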